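(* Let $K$ be a $CVD$-kernel, let $n\ge 1$ be an integer, and let $0<h<\pi/n$. Then: (i) if $\mu(K)=1$, then $$R_{n,h}(K*F_1)=R(K*F_1;q_{n,h,2\pi/n})=\inf_{\lambda\in\mathbb{R}}\left\|M(q_{n,h,2\pi/n};\cdot)-\lambda\right\|_\infty ;$$ (ii) if $\mu(K)=0$, then $$R_{n,h}(K*F_1)=\inf_{\lambda\in\mathbb{R}}R(K*F_1;q_{n,h,\lambda})=\inf_{\lambda\in\mathbb{R}}\left\|M(q_{n,h,\lambda};\cdot)\right\|_\infty .$$
   Context: All functions are real-valued and $2\pi$-periodic. $C$ and $L_p$ ($1\le p\le\infty$) are the spaces of $2\pi$-periodic continuous, respectively $L_p$ (over a period), functions with the usual norms; $\|\cdot\|_p$ is the norm of $L_p$. For $K,\phi\in L_1$ the convolution is $K*\phi(x)=\int_0^{2\pi}K(x-t)\phi(t)\,dt$. For a kernel $K\in L_1$ put $\mu=\mu(K)=1$ if $\int_0^{2\pi}K(t)\,dt=0$ and $\mu=\mu(K)=0$ if $\int_0^{2\pi}K(t)\,dt\ne 0$. The relation $\phi\perp\mu$ means $\int_0^{2\pi}\mu\,\phi(t)\,dt=0$ (so it is no restriction when $\mu=0$, and means that $\phi$ has zero mean when $\mu=1$). $\nu(f)$ denotes the number of sign changes of a $2\pi$-periodic function $f$ over a period (counted cyclically: the supremum of those $N$ for which there are points $y_1<\dots<y_N<y_1+2\pi$ at which $f$ takes nonzero values whose signs alternate cyclically, i.e. $f(y_i)f(y_{i+1})<0$ for $1\le i\le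 N$ with $y_{N+1}=y_1$; it is $0$ if there are none). A kernel $K$ is a $CVD$-kernel if $\nu(f)\le\nu(\phi)$ for every function of the form $f(x)=a\mu+K*\phi(x)$ with $a\in\mathbb{R}$, $\phi\in C$, $\phi\perp\mu$. $F_1$ is the unit ball of $L_1$, and $K*F_1$ is the class of all functions $f=a\mu+K*\phi$ with $a\in\mathbb{R}$, $\phi\in F_1$, $\phi\perp\mu$. For an integer $n\ge1$ and $0<h<\pi/n$, $Q_{n,h}$ is the set of all functionals $$q(f)=\sum_{k=1}^n c_k\frac1{2h}\int_{x_k-h}^{x_k+h}f(t)\,dt,$$ where $c_k\in\mathbb{R}$ and $x_1+h<x_2-h<x_2+h<\dots<x_n-h<x_n+h<x_1+2\pi-h$. Put $$R(f,q)=\int_0^{2\pi}f(t)\,dt-q(f),\qquad R(K*F_1;q)=\sup_{f\in K*F_1}|R(f,q)|,\qquad R_{n,h}(K*F_1)=\inf_{q\in Q_{n,h}}R(K*F_1;q).$$ For $q\in Q_{n,h}$ put $$H(q;t)=\frac1{2h}\sum_{k=1}^n c_k\,\chi_{(x_k-h,x_k+h)}(t),\qquad M(q;u)=\int_0^{2\pi}K(t-u)\,[1-H(q;t)]\,dt,$$ where the indicator functions $\chi_{(x_k-h,x_k+h)}$ of the intervals are extended $2\pi$-periodically to the real line. For $\lambda\in\mathbb{R}$, $q_{n,h,\lambda}$ is the functional with equal coefficients and equidistant nodes $$q_{n,h,\lambda}(f)=\lambda\sum_{k=1}^n\frac1{2h}\int_{2k\pi/n-h}^{2k\pi/n+h}f(t)\,dt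 .$$ *)

theory Defs
  imports "HOL-Probability.Essential_Supremum" "HOL-Library.Extended_Nat"
begin

definition periodic_2pi :: "(real \<Rightarrow> real) \<Rightarrow> bool" where
  "periodic_2pi f \<longleftrightarrow> (\<forall>x. f (x + 2*pi) = f x)"

definition C_per :: "(real \<Rightarrow> real) set" where
  "C_per = {f. periodic_2pi f \<and> continuous_on UNIV f}"

definition L1_per :: "(real \<Rightarrow> real) set" where
  "L1_per = {f. periodic_2pi f \<and> set_integrable lebesgue {0..2*pi} f}"

definition L1_norm :: "(real \<Rightarrow> real) \<Rightarrow> real" where
  "L1_norm f = (LINT t:{0..2*pi}|lebesgue. \<bar>f t\<bar>)"

definition Linf_norm :: "(real \<Rightarrow> real) \<Rightarrow> ereal" where
  "Linf_norm f = esssup (restrict_space lebesgue {0..2*pi}) (\<lambda>t. ereal \<bar>f t\<bar>)"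

text \<open>For \<open>K\<close> and \<open>\<phi>\<close> in \<open>L1_per\<close> the integrand may fail to be integrable for \<open>x\<close> in a null set;
  there the value is \<open>0\<close>.\<close>
definition conv_per :: "(real \<Rightarrow> real) \<Rightarrow> (real \<Rightarrow> real) \<Rightarrow> real \<Rightarrow> real" where
  "conv_per K \<phi> x = (LINT t:{0..2*pi}|lebesgue. K (x - t) * \<phi> t)"

definition mu :: "(real \<Rightarrow> real) \<Rightarrow> real" where
  "mu K = (if (LINT t:{0..2*pi}|lebesgue. K t) = 0 then 1 else 0)"

definition perp :: "(real \<Rightarrow> real) \<Rightarrow> real \<Rightarrow> bool" where
  "perp \<phi> m \<longleftrightarrow> (LINT t:{0..2*pi}|lebesgue. m * \<phi> t) = 0"

text \<open>In \<open>enat\<close> the supremum of the empty set is \<open>0\<close>.\<close>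
definition sign_changes :: "(real \<Rightarrow> real) \<Rightarrow> enat" where
  "sign_changes f = Sup {enat N | N. N \<ge> 1 \<and>
     (\<exists>y :: nat \<Rightarrow> real. (\<forall>i\<in>{1..<N}. y i < y (Suc i)) \<and> y N < y 1 + 2*pi \<and>
        y (Suc N) = y 1 \<and> (\<forall>i\<in>{1..N}. f (y i) * f (y (Suc i)) < 0))}"

definition CVD_kernel :: "(real \<Rightarrow> real) \<Rightarrow> bool" where
  "CVD_kernel K \<longleftrightarrow> K \<in> L1_per \<and>
     (\<forall>a. \<forall>\<phi>\<in>C_per. perp \<phi> (mu K) \<longrightarrow>
        sign_changes (\<lambda>x. a * mu K + conv_per K \<phi> x) \<le> sign_changes \<phi>)"

definition F1 :: "(real \<Rightarrow> real) set" where
  "F1 = {\<phi> \<in> L1_per. L1_norm \<phi> \<le> 1}"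

definition conv_class :: "(real \<Rightarrow> real) \<Rightarrow> (real \<Rightarrow> real) set" where
  "conv_class K = {(\<lambda>x. a * mu K + conv_per K \<phi> x) | a \<phi>. \<phi> \<in> F1 \<and> perp \<phi> (mu K)}"

text \<open>A quadrature functional is given by its coefficients \<open>c 1, \<dots>, c n\<close> and its nodes
  \<open>x 1, \<dots>, x n\<close>; the values of \<open>c\<close> and \<open>x\<close> at other indices are irrelevant.\<close>
definition quad :: "nat \<Rightarrow> real \<Rightarrow> (nat \<Rightarrow> real) \<Rightarrow> (nat \<Rightarrow> real) \<Rightarrow> (real \<Rightarrow> real) \<Rightarrow> real" where
  "quad n h c x f =
     (\<Sum>k=1..n. c k * (1 / (2*h)) * (LINT t:{x k - h..x k + h}|lebesgue. f t))"

definition admissible_nodes :: "nat \<Rightarrow> real \<Rightarrow> (nat \<Rightarrow> real) \<Rightarrow> bool" where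
  "admissible_nodes n h x \<longleftrightarrow>
     (\<forall>k\<in>{1..<n}. x k + h < x (Suc k) - h) \<and> x n + h < x 1 + 2*pi - h"

definition Q_set :: "nat \<Rightarrow> real \<Rightarrow> ((real \<Rightarrow> real) \<Rightarrow> real) set" where
  "Q_set n h = {quad n h c x | c x. admissible_nodes n h x}"

definition quad_rem :: "(real \<Rightarrow> real) \<Rightarrow> ((real \<Rightarrow> real) \<Rightarrow> real) \<Rightarrow> real" where
  "quad_rem f q = (LINT t:{0..2*pi}|lebesgue. f t) - q f"

text \<open>Extended real values are needed: for \<open>mu K = 1\<close> the class contains all constants, so the
  error is infinite unless the coefficients of \<open>q\<close> sum to \<open>2*pi\<close>.\<close>
definition class_error :: "(real \<Rightarrow> real) \<Rightarrow> ((real \<Rightarrow> real) \<Rightarrow> real) \<Rightarrow> ereal" where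
  "class_error K q = (SUP f\<in>conv_class K. ereal \<bar>quad_rem f q\<bar>)"

definition optimal_error :: "(real \<Rightarrow> real) \<Rightarrow> nat \<Rightarrow> real \<Rightarrow> ereal" where
  "optimal_error K n h = (INF q\<in>Q_set n h. class_error K q)"

definition H_fun :: "nat \<Rightarrow> real \<Rightarrow> (nat \<Rightarrow> real) \<Rightarrow> (nat \<Rightarrow> real) \<Rightarrow> real \<Rightarrow> real" where
  "H_fun n h c x t = 1 / (2*h) *
     (\<Sum>k=1..n. c k * indicat_real (\<Union>j::int. {x k - h + 2*pi*j <..< x k + h + 2*pi*j}) t)"

definition M_fun ::
  "(real \<Rightarrow> real) \<Rightarrow> nat \<Rightarrow> real \<Rightarrow> (nat \<Rightarrow> real) \<Rightarrow> (nat \<Rightarrow> real) \<Rightarrow> real \<Rightarrow> real" where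
  "M_fun K n h c x u = (LINT t:{0..2*pi}|lebesgue. K (t - u) * (1 - H_fun n h c x t))"

definition equi_nodes :: "nat \<Rightarrow> nat \<Rightarrow> real" where
  "equi_nodes n k = 2 * real k * pi / real n"

abbreviation equi_quad :: "nat \<Rightarrow> real \<Rightarrow> real \<Rightarrow> (real \<Rightarrow> real) \<Rightarrow> real" where
  "equi_quad n h lam \<equiv> quad n h (\<lambda>_. lam) (equi_nodes n)"

abbreviation equi_M :: "(real \<Rightarrow> real) \<Rightarrow> nat \<Rightarrow> real \<Rightarrow> real \<Rightarrow> real \<Rightarrow> real" where
  "equi_M K n h lam \<equiv> M_fun K n h (\<lambda>_. lam) (equi_nodes n)"

end

theory Submission
  imports Defs
begin

text \<open>The error of a quadrature functional \<open>q\<close> on \<open>K * F1\<close> is a dual norm: by Fubini the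
  remainder of \<open>a * mu K + K * \<phi>\<close> is
  \<open>a * mu K * (2*pi - \<Sum> c) + \<integral> \<phi> M(q; \<cdot>)\<close> (\<open>quad_rem_conv\<close>), and \<open>M(q; \<cdot>)\<close> is continuous and
  periodic. Hence for \<open>mu K = 0\<close> the error is the maximum of \<open>\<bar>M(q; \<cdot>)\<bar>\<close>
  (\<open>class_error_eq_Linf_norm\<close>). For \<open>mu K = 1\<close> it is infinite unless the coefficients sum to
  \<open>2*pi\<close>, and then it is the distance of \<open>M(q; \<cdot>)\<close> from the constants
  (\<open>class_error_le_iff_near_constant\<close>).

  Optimality of the equidistant functional is a zero count. The function \<open>M\<close> of the equidistant
  functional with coefficient \<open>lam\<close> has period \<open>2*pi/n\<close>. If it takes one value above \<open>m\<close> and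
  one below \<open>-m\<close>, both up to the same additive constant when \<open>mu K = 1\<close>, it therefore does so
  alternately at \<open>2*n\<close> points of a period. So do its translates. If some other \<open>q\<close> had
  \<open>\<bar>M(q; \<cdot>)\<bar> \<le> m\<close>, up to a constant, the difference of the two functions would change sign
  \<open>2*n\<close> times. But that difference is, up to a constant, the correlation of \<open>K\<close> with
  \<open>g = H(q; \<cdot>) - H(q'; \<cdot>)\<close>, where \<open>q'\<close> is the translated equidistant functional. Both step
  functions consist of \<open>n\<close> steps of the same width \<open>2*h\<close>, and the translation is chosen so that
  one step of \<open>q'\<close> sits exactly on a step of \<open>q\<close>. Equal widths prevent a step from
  sticking out on both sides of another one, and the aligned pair contributes a single sign, so
  \<open>g\<close> has at most \<open>2*n - 2\<close> sign changes (\<open>sign_changes_bump_difference_le\<close>). As \<open>K\<close> does not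
  increase the number of sign changes, this is a contradiction (\<open>no_uniformly_smaller_M_fun\<close>). The
  defining property of a CVD kernel speaks only of continuous functions; it is carried over to
  step functions by damping them to zero near their jumps, which creates no new signs
  (\<open>CVD_kernel_piecewise_continuous\<close>).

  For \<open>mu K = 1\<close> the coefficient must be \<open>2*pi/n\<close>, which makes \<open>g\<close> have mean zero. For
  \<open>mu K = 0\<close> the coefficient is free, and it is adjusted until one extreme value of the
  equidistant \<open>M\<close> lies exactly on the boundary of a slightly enlarged error band; the other
  extreme value then has to leave the band on the opposite side (\<open>equi_quad_optimal_mu_0\<close>).\<close>

section \<open>Sign changes\<close>

text \<open>The values of \<open>y\<close> outside \<open>{1..Suc N}\<close> are arbitrary; \<open>y (Suc N)\<close> closes the cycle.\<close>

definition alternates :: "(real \<Rightarrow> real) \<Rightarrow> nat \<Rightarrow> (nat \<Rightarrow> real) \<Rightarrow> bool" where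
  "alternates f N y \<longleftrightarrow> N \<ge> 1 \<and> (\<forall>i\<in>{1..<N}. y i < y (Suc i)) \<and> y N < y 1 + 2*pi \<and>
     y (Suc N) = y 1 \<and> (\<forall>i\<in>{1..N}. f (y i) * f (y (Suc i)) < 0)"

lemma sign_changes_eq_Sup: "sign_changes f = Sup {enat N | N. \<exists>y. alternates f N y}"
  unfolding sign_changes_def alternates_def by (rule arg_cong[where f=Sup]) blast

lemma sign_changes_ge: "alternates f N y \<Longrightarrow> enat N \<le> sign_changes f"
  unfolding sign_changes_eq_Sup by (rule Sup_upper) auto

lemma sign_changes_le: "(\<And>N y. alternates f N y \<Longrightarrow> N \<le> B) \<Longrightarrow> sign_changes f \<le> enat B"
  unfolding sign_changes_eq_Sup by (rule Sup_least) auto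

lemma sign_changes_mono:
  assumes "\<And>s t. f s * f t < 0 \<Longrightarrow> g s * g t < 0"
  shows "sign_changes f \<le> sign_changes g"
proof -
  have "alternates f N y \<Longrightarrow> alternates g N y" for N y
    using assms by (simp add: alternates_def)
  then show ?thesis unfolding sign_changes_eq_Sup by (intro Sup_subset_mono) blast
qed

text \<open>Reflection reverses the order of the points, and the closing point becomes the negative of
  the last one.\<close>

lemma alternates_reflect:
  assumes "alternates (\<lambda>x. f (- x)) N y"
  shows "\<exists>y'. alternates f N y'"
proof -
  have N: "N \<ge> 1" and inc: "\<And>i. i \<in> {1..<N} \<Longrightarrow> y i < y (Suc i)" and per: "y N < y 1 + 2*pi"
    and cl: "y (Suc N) = y 1" and alt: "\<And>i. i\<in>{1..N} \<Longrightarrow> f (- y i) * f (- y (Suc i)) < 0"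
    using assms by (auto simp: alternates_def)
  define z where "z i = (if i = Suc N then - y N else - y (Suc N - i))" for i
  have "z i < z (Suc i)" if "i \<in> {1..<N}" for i
    using inc[of "N - i"] that by (auto simp: z_def Suc_diff_le)
  moreover have "f (z i) * f (z (Suc i)) < 0" if "i \<in> {1..N}" for i
  proof (cases "i = N")
    case True
    then show ?thesis using alt[of N] N cl by (simp add: z_def mult.commute)
  next
    case False
    then show ?thesis using alt[of "N - i"] that by (auto simp: z_def mult.commute Suc_diff_le)
  qed
  moreover have "z N < z 1 + 2*pi" "z (Suc N) = z 1" using per N by (auto simp: z_def)
  ultimately have "alternates f N z" using N by (auto simp: alternates_def)
  then show ?thesis by blast
qed

lemma sign_changes_reflect: "sign_changes (\<lambda>x. f (- x)) = sign_changes f"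
proof -
  have "(\<exists>y. alternates (\<lambda>x. f (- x)) N y) \<longleftrightarrow> (\<exists>y. alternates f N y)" for N
    using alternates_reflect[of f N] alternates_reflect[of "\<lambda>x. f (- x)" N] by auto
  then show ?thesis by (simp add: sign_changes_eq_Sup)
qed

lemma periodic_int_multiple:
  fixes p :: real
  assumes "\<And>u. P (u + p) = P u"
  shows "P (u + p * real_of_int j) = P u"
proof (induction j rule: int_induct[where k=0])
  case (step1 i)
  then show ?case using assms[of "u + p * real_of_int i"] by (simp add: algebra_simps)
next
  case (step2 i)
  then show ?case using assms[of "u + p * real_of_int (i - 1)"] by (simp add: algebra_simps)
qed simp

lemma periodic_2pi_int: "periodic_2pi f \<Longrightarrow> f (x + 2*pi* of_int j) = f x"
  by (rule periodic_int_multiple) (simp add: periodic_2pi_def)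

lemma periodic_2pi_value_in_period:
  assumes "periodic_2pi f"
  obtains s where "s \<in> {0..2*pi}" "f s = f t"
proof -
  define j where "j = \<lfloor>t / (2*pi)\<rfloor>"
  have "of_int j \<le> t / (2*pi)" "t / (2*pi) < of_int j + 1" unfolding j_def by linarith+
  then have "t + 2*pi* of_int (-j) \<in> {0..2*pi}" by (auto simp: field_simps)
  then show ?thesis using periodic_2pi_int[OF assms, of t "-j"] that by blast
qed

text \<open>The arc of radius \<open>h\<close> about \<open>x\<close> on the circle, lifted to the line. These are the sets whose
  indicators make up \<^const>\<open>H_fun\<close>.\<close>

definition arcs :: "real \<Rightarrow> real \<Rightarrow> real set" where
  "arcs h x = (\<Union>j::int. {x - h + 2*pi*j <..< x + h + 2*pi*j})"

lemma mem_arcs: "t \<in> arcs h x \<longleftrightarrow> (\<exists>j::int. \<bar>t - x - 2*pi*j\<bar> < h)"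
  unfolding arcs_def by (auto simp: abs_less_iff) (smt (verit))+

lemma alternates_mono:
  assumes "alternates f N y" "1 \<le> i" "i < k" "k \<le> N"
  shows "y i < y k"
  using assms(3,4)
proof (induction k)
  case (Suc k)
  have "y k < y (Suc k)" using assms Suc by (auto simp: alternates_def)
  then show ?case using Suc by (cases "i = k") auto
qed simp

text \<open>The cyclic successor maps positive points injectively to negative points and conversely, so
  there are equally many of both.\<close>

lemma alternates_even:
  assumes "alternates f N y"
  shows "N = 2 * card {i\<in>{1..N}. f (y i) > 0}"
proof -
  define P where "P = {i\<in>{1..N}. f (y i) > 0}"
  define Q where "Q = {i\<in>{1..N}. f (y i) < 0}"
  define s where "s i = (if i = N then 1 else Suc i)" for i
  have alt: "f (y i) * f (y (s i)) < 0" if "i \<in> {1..N}" for i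
  proof -
    have "y (s i) = y (Suc i)" using assms by (simp add: alternates_def s_def)
    then show ?thesis using assms that by (simp add: alternates_def)
  qed
  have inj: "inj_on s {1..N}" by (auto simp: inj_on_def s_def split: if_splits)
  have s: "s i \<in> {1..N}" if "i \<in> {1..N}" for i using that by (auto simp: s_def)
  have "s ` P \<subseteq> Q" "s ` Q \<subseteq> P"
    using alt s unfolding P_def Q_def by (fastforce simp: mult_less_0_iff)+
  moreover have "finite P" "finite Q" by (auto simp: P_def Q_def)
  moreover have "inj_on s P" "inj_on s Q"
    by (rule inj_on_subset[OF inj], force simp: P_def Q_def)+
  ultimately have "card P = card Q" by (meson card_inj_on_le le_antisym)
  moreover have "{1..N} = P \<union> Q" using alt by (fastforce simp: P_def Q_def mult_less_0_iff)
  moreover have "P \<inter> Q = {}" by (auto simp: P_def Q_def)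
  ultimately show ?thesis
    using card_Un_disjoint[OF \<open>finite P\<close> \<open>finite Q\<close>] unfolding P_def[symmetric]
    by (metis card_atLeastAtMost diff_Suc_1 mult_2)
qed

text \<open>A count of sign changes by the intervals that carry the positive values. Two positive points
  of an alternating cycle are separated by a negative one on either side, so by \<open>sep\<close> they cannot
  share an arc. Hence the positive points inject into \<open>A\<close>, and they are half of all points.\<close>

lemma alternates_le_twice_cover:
  assumes alt: "alternates g N y" and per: "periodic_2pi g" and A: "finite A" and h: "h < pi"
    and cover: "\<And>t. g t > 0 \<Longrightarrow> \<exists>k\<in>A. t \<in> arcs h (x k)"
    and sep: "\<And>k p z q. k \<in> A \<Longrightarrow> \<bar>p - x k\<bar> < h \<Longrightarrow> \<bar>q - x k\<bar> < h \<Longrightarrow> p < z \<Longrightarrow> z < q \<Longrightarrow>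
                g p > 0 \<Longrightarrow> g q > 0 \<Longrightarrow> g z \<ge> 0"
  shows "N \<le> 2 * card A"
proof -
  define P where "P = {i\<in>{1..N}. g (y i) > 0}"
  have sep': "g z \<ge> 0" if "k \<in> A" "\<bar>p - x k - 2*pi* of_int j\<bar> < h" "\<bar>q - x k - 2*pi* of_int j\<bar> < h"
      "p < z" "z < q" "g p > 0" "g q > 0" for k p z q and j::int
    using sep[of k "p - 2*pi* of_int j" "q - 2*pi* of_int j" "z - 2*pi* of_int j"] that
      periodic_2pi_int[OF per, of _ "-j"] by (simp add: algebra_simps)
  have N: "N \<ge> 1" and bd: "y N < y 1 + 2*pi"
    and neg: "\<And>i. i \<in> {1..<N} \<Longrightarrow> g (y i) > 0 \<Longrightarrow> g (y (Suc i)) < 0"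
    using alt by (fastforce simp: alternates_def mult_less_0_iff)+
  have "g (y N) * g (y 1) < 0" using alt N unfolding alternates_def
    by (metis atLeastAtMost_iff order_refl)
  then have neg1: "g (y N) > 0 \<Longrightarrow> g (y 1) < 0" by (simp add: mult_less_0_iff)
  note mono = alternates_mono[OF alt]
  have "\<forall>i\<in>P. \<exists>k\<in>A. y i \<in> arcs h (x k)" using cover by (auto simp: P_def)
  then obtain k where k: "\<And>i. i \<in> P \<Longrightarrow> k i \<in> A \<and> y i \<in> arcs h (x (k i))" by metis
  have ne: False if "i \<in> P" "i' \<in> P" "i < i'" "k i = k i'" for i i'
  proof -
    from k[OF that(1)] k[OF that(2)] that(4)
    obtain j j' :: int where j: "\<bar>y i - x (k i) - 2*pi*j\<bar> < h" and j': "\<bar>y i' - x (k i) - 2*pi*j'\<bar> < h"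
      by (auto simp: mem_arcs)
    have i: "1 \<le> i" "i' \<le> N" "g (y i) > 0" "g (y i') > 0" using that by (auto simp: P_def)
    have ypos: "y i < y i'" using mono that i by auto
    have yN: "y i' \<le> y N" "y 1 \<le> y i" using mono[of i' N] mono[of 1 i] that i by force+
    have "2*pi* of_int (j' - j) < 2*pi*2" "2*pi* of_int (j' - j) > 2*pi*(-1)"
      using j j' ypos yN bd h by (auto simp: algebra_simps)
    then have "of_int (j' - j) < (2::real)" "of_int (j' - j) > (-1::real)"
      using mult_less_cancel_left_pos[of "2*pi"] pi_gt_zero by (blast intro: mult_pos_pos zero_less_numeral)+
    then have "j' = j \<or> j' = j + 1" by linarith
    \<comment> \<open>If both points lie in the same lift of the arc, the separating point is the successor of the
      first. Otherwise the first point has to be moved on by a period, and the separating point is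
      the successor of the second.\<close>
    then show False
    proof
      assume "j' = j"
      have n: "g (y (Suc i)) < 0" using neg[of i] i that by auto
      then have "Suc i \<noteq> i'" using i by auto
      then have "y (Suc i) < y i'" "y i < y (Suc i)" using mono[of "Suc i" i'] mono[of i "Suc i"] that i by auto
      then show False using sep'[of "k i" "y i" j "y i'" "y (Suc i)"] n j j' \<open>j' = j\<close> i k[OF that(1)] by auto
    next
      assume "j' = j + 1"
      define q where "q = y i + 2*pi"
      have gq: "g q > 0" using per i by (auto simp: q_def periodic_2pi_def)
      have cq: "\<bar>q - x (k i) - 2*pi* of_int j'\<bar> < h" using j \<open>j' = j + 1\<close> by (simp add: q_def algebra_simps)
      have "\<exists>z. y i' < z \<and> z < q \<and> g z < 0"
      proof (cases "i' = N")
        case True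
        have n1: "g (y 1) < 0" using neg1 i True by auto
        then have "i \<noteq> 1" using i by auto
        then have "y 1 < y i" using mono[of 1 i] i that by auto
        moreover have "g (y 1 + 2*pi) = g (y 1)" using per by (simp add: periodic_2pi_def)
        ultimately show ?thesis using n1 True bd by (intro exI[of _ "y 1 + 2*pi"]) (simp add: q_def)
      next
        case False
        then have "g (y (Suc i')) < 0" using neg[of i'] i that by auto
        moreover have "y i' < y (Suc i')" using mono[of i' "Suc i'"] i False that(3) by auto
        moreover have "y (Suc i') \<le> y N"
          using mono[of "Suc i'" N] i False by (cases "Suc i' = N") auto
        ultimately show ?thesis using yN bd by (intro exI[of _ "y (Suc i')"]) (simp add: q_def)
      qed
      then obtain z where z: "y i' < z" "z < q" "g z < 0" by blast
      from z show False using sep'[of "k i" "y i'" j' q z] j' cq gq i k[OF that(1)] by auto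
    qed
  qed
  have "inj_on k P" by (rule inj_onI) (metis ne linorder_neqE_nat)
  then have "card P \<le> card A" using k A by (intro card_inj_on_le) auto
  then show ?thesis using alternates_even[OF alt] unfolding P_def[symmetric] by simp
qed

section \<open>Sign changes of a difference of step functions with equally wide steps\<close>

lemma admissible_nodes_gap:
  assumes "admissible_nodes n h x" "h > 0" "1 \<le> k" "k < l" "l \<le> n"
  shows "x l - x k > 2*h"
  using assms(4,5)
proof (induction l)
  case (Suc l)
  have "x l + h < x (Suc l) - h" using assms Suc by (auto simp: admissible_nodes_def)
  then show ?case using Suc assms(2) by (cases "k = l") auto
qed simp

lemma admissible_nodes_spread:
  assumes "admissible_nodes n h x" "h > 0" "1 \<le> k" "k \<le> l" "l \<le> n"
  shows "x l - x k < 2*pi - 2*h"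
proof -
  have "x n - x l \<ge> 0" "x k - x 1 \<ge> 0"
    using admissible_nodes_gap[OF assms(1,2), of l n] admissible_nodes_gap[OF assms(1,2), of 1 k] assms
    by (cases "l = n"; cases "k = 1"; auto)+
  then show ?thesis using assms by (auto simp: admissible_nodes_def)
qed

lemma arcs_disjoint:
  assumes "admissible_nodes n h x" "h > 0" "k \<in> {1..n}" "l \<in> {1..n}" "k \<noteq> l"
  shows "arcs h (x k) \<inter> arcs h (x l) = {}"
proof -
  have *: False if "k < l" "k \<in> {1..n}" "l \<in> {1..n}" "t \<in> arcs h (x k)" "t \<in> arcs h (x l)" for k l t
  proof -
    from that obtain i j :: int where ij: "\<bar>t - x k - 2*pi*i\<bar> < h" "\<bar>t - x l - 2*pi*j\<bar> < h"
      unfolding mem_arcs by blast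
    have "x l - x k > 2*h" "x l - x k < 2*pi - 2*h"
      using admissible_nodes_gap[OF assms(1,2)] admissible_nodes_spread[OF assms(1,2)] that by auto
    then have "2*pi*(real_of_int i - real_of_int j) < 2*pi*1" "2*pi*(real_of_int i - real_of_int j) > 2*pi*0"
      using ij unfolding abs_less_iff right_diff_distrib by linarith+
    then have "real_of_int i - real_of_int j < 1" "real_of_int i - real_of_int j > 0"
      using pi_gt_zero by (auto simp: zero_less_mult_iff)
    then have "i < j + 1" "j < i" by linarith+
    then show False by linarith
  qed
  show ?thesis using *[of k l] *[of l k] assms by (cases k l rule: linorder_cases) auto
qed

lemma H_fun_arcs: "H_fun n h c x t = 1 / (2*h) * (\<Sum>k=1..n. c k * indicat_real (arcs h (x k)) t)"
  by (simp add: H_fun_def arcs_def)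

lemma H_fun_on_arc:
  assumes "admissible_nodes n h x" "h > 0" "k \<in> {1..n}" "t \<in> arcs h (x k)"
  shows "H_fun n h c x t = c k / (2*h)"
proof -
  have "indicat_real (arcs h (x l)) t = (if l = k then 1 else 0)" if "l \<in> {1..n}" for l
    using arcs_disjoint[OF assms(1,2,3) that] assms(4) by (auto simp: indicator_def)
  then have "(\<Sum>l=1..n. c l * indicat_real (arcs h (x l)) t) = (\<Sum>l=1..n. if l = k then c k else 0)"
    by (intro sum.cong) auto
  then show ?thesis using assms(3) by (simp add: H_fun_arcs)
qed

lemma H_fun_off_arcs: "(\<And>k. k \<in> {1..n} \<Longrightarrow> t \<notin> arcs h (x k)) \<Longrightarrow> H_fun n h c x t = 0"
  by (simp add: H_fun_arcs)

lemma H_fun_nonneg: "h > 0 \<Longrightarrow> (\<And>k. k \<in> {1..n} \<Longrightarrow> c k \<ge> 0) \<Longrightarrow> H_fun n h c x t \<ge> 0"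
  unfolding H_fun_arcs by (intro mult_nonneg_nonneg sum_nonneg) auto

lemma arcs_periodic: "t + 2*pi \<in> arcs h x \<longleftrightarrow> t \<in> arcs h x"
proof -
  have "\<bar>t + 2*pi - x - 2*pi*j\<bar> < h \<longleftrightarrow> \<bar>t - x - 2*pi*(j-1)\<bar> < h" for j :: int
    by (simp add: algebra_simps)
  then show ?thesis unfolding mem_arcs by (metis diff_add_cancel add_diff_cancel)
qed

lemma H_fun_periodic: "periodic_2pi (H_fun n h c x)"
  by (simp add: periodic_2pi_def H_fun_arcs indicator_def arcs_periodic)

text \<open>A positive value of the difference needs a positive step of the first function. If there were a
  negative value between two positive ones within one such step, a step of the second function
  would have to lie strictly inside it, which is impossible for equal widths. So each step of the
  first function accounts for at most one positive point, and the step \<open>k0\<close> for none.\<close>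

lemma alternates_bump_difference_le:
  assumes x: "admissible_nodes n h x" and z: "admissible_nodes n h z" and h: "h > 0"
    and d: "\<And>l. l \<in> {1..n} \<Longrightarrow> d l \<ge> 0" and k0: "k0 \<in> {1..n}"
    and le: "\<And>t. t \<in> arcs h (x k0) \<Longrightarrow> H_fun n h c x t \<le> H_fun n h d z t"
    and alt: "alternates (\<lambda>t. H_fun n h c x t - H_fun n h d z t) N y"
  shows "N \<le> 2 * (n - 1)"
proof -
  let ?F = "H_fun n h c x" and ?G = "H_fun n h d z"
  have hpi: "h < pi" using admissible_nodes_spread[OF x h, of 1 1] k0 by auto
  have G0: "?G t \<ge> 0" for t by (rule H_fun_nonneg) (use h d in auto)
  have "N \<le> 2 * card ({1..n} - {k0})"
  proof (rule alternates_le_twice_cover[OF alt _ _ hpi])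
    show "periodic_2pi (\<lambda>t. ?F t - ?G t)"
      using H_fun_periodic by (simp add: periodic_2pi_def)
    show "\<exists>k\<in>{1..n} - {k0}. t \<in> arcs h (x k)" if "?F t - ?G t > 0" for t
    proof -
      have "?F t > 0" using that G0[of t] by simp
      then obtain k where "k \<in> {1..n}" "t \<in> arcs h (x k)" using H_fun_off_arcs[of n t h x c] by force
      moreover have "k \<noteq> k0" using le[of t] that calculation by auto
      ultimately show ?thesis by auto
    qed
    fix k p s q
    assume k: "k \<in> {1..n} - {k0}" and pq: "\<bar>p - x k\<bar> < h" "\<bar>q - x k\<bar> < h" "p < s" "s < q"
      "?F p - ?G p > 0" "?F q - ?G q > 0"
    have arc: "t \<in> arcs h (x k)" if "p \<le> t" "t \<le> q" for t
      unfolding mem_arcs by (rule exI[of _ 0]) (use that pq in auto)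
    have F: "?F t = c k / (2*h)" if "p \<le> t" "t \<le> q" for t
      using H_fun_on_arc[OF x h _ arc[OF that]] k by simp
    show "?F s - ?G s \<ge> 0"
    proof (rule ccontr)
      assume "\<not> ?thesis"
      then have lt: "?G p < ?G s" "?G q < ?G s" using F pq by auto
      then have "?G s > 0" using G0[of p] by simp
      then obtain l where l: "l \<in> {1..n}" "s \<in> arcs h (z l)" using H_fun_off_arcs[of n s h z d] by force
      then obtain j :: int where j: "\<bar>s - z l - 2*pi*j\<bar> < h" by (auto simp: mem_arcs)
      have "t \<notin> arcs h (z l)" if "?G t < ?G s" for t
        using H_fun_on_arc[OF z h l(1)] l that by force
      then have "p \<notin> arcs h (z l)" "q \<notin> arcs h (z l)" using lt by auto
      then have "\<bar>p - z l - 2*pi*j\<bar> \<ge> h" "\<bar>q - z l - 2*pi*j\<bar> \<ge> h"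
        unfolding mem_arcs by (meson not_le)+
      then show False using j pq by linarith
    qed
  qed auto
  then show ?thesis using k0 by simp
qed

text \<open>Some step can always be discarded in \<open>alternates_bump_difference_le\<close>: a step with nonpositive
  coefficient, or else the aligned step, on which the difference is constant. If the first function
  dominates there, the roles of the two functions are exchanged; that needs nonnegative
  coefficients, which is why nonpositive ones are treated first.\<close>

lemma sign_changes_bump_difference_le:
  assumes x: "admissible_nodes n h x" and z: "admissible_nodes n h z" and h: "h > 0" and n: "n \<ge> 1"
    and eq: "x 1 = z 1" and lam: "lam > 0"
  shows "sign_changes (\<lambda>t. H_fun n h c x t - H_fun n h (\<lambda>_. lam) z t) \<le> enat (2 * (n - 1))"
proof (rule sign_changes_le)
  fix N y assume alt: "alternates (\<lambda>t. H_fun n h c x t - H_fun n h (\<lambda>_. lam) z t) N y"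
  have one: "1 \<in> {1..n}" using n by simp
  consider (1) k0 where "k0 \<in> {1..n}" "c k0 \<le> 0" | (2) "c 1 \<le> lam"
    | (3) "\<And>k. k \<in> {1..n} \<Longrightarrow> c k \<ge> 0" "c 1 \<ge> lam" by force
  then show "N \<le> 2 * (n - 1)"
  proof cases
    case 1
    have "H_fun n h c x t \<le> H_fun n h (\<lambda>_. lam) z t" if "t \<in> arcs h (x k0)" for t
      using H_fun_on_arc[OF x h 1(1) that, of c] 1 h lam H_fun_nonneg[OF h, of n "\<lambda>_. lam" z t]
      by (smt (verit) divide_nonpos_pos)
    then show ?thesis using alternates_bump_difference_le[OF x z h _ 1(1) _ alt] lam by simp
  next
    case 2
    have "H_fun n h c x t \<le> H_fun n h (\<lambda>_. lam) z t" if "t \<in> arcs h (x 1)" for t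
      using H_fun_on_arc[OF x h one that, of c] H_fun_on_arc[OF z h one, of t "\<lambda>_. lam"] that eq 2 h
      by (simp add: divide_right_mono)
    then show ?thesis using alternates_bump_difference_le[OF x z h _ one _ alt] lam by simp
  next
    case 3
    have "H_fun n h (\<lambda>_. lam) z t \<le> H_fun n h c x t" if "t \<in> arcs h (z 1)" for t
      using H_fun_on_arc[OF x h one, of t c] H_fun_on_arc[OF z h one, of t "\<lambda>_. lam"] that eq 3 h
      by (simp add: divide_right_mono)
    moreover have "alternates (\<lambda>t. H_fun n h (\<lambda>_. lam) z t - H_fun n h c x t) N y"
      using alt by (simp add: alternates_def algebra_simps)
    ultimately show ?thesis by (intro alternates_bump_difference_le[OF z x h 3(1) one])
  qed
qed

section \<open>Integrals of periodic functions\<close>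

lemma set_integral_shift:
  fixes f :: "real \<Rightarrow> real"
  shows "(LINT t:{a..b}|lebesgue. f (t + s)) = (LINT t:{a+s..b+s}|lebesgue. f t)"
    and "set_integrable lebesgue {a..b} (\<lambda>t. f (t + s)) \<longleftrightarrow> set_integrable lebesgue {a+s..b+s} f"
proof -
  have eq: "indicat_real {a+s..b+s} (s + 1 * t) *\<^sub>R f (s + 1 * t) = indicat_real {a..b} t *\<^sub>R f (t + s)" for t
    by (auto simp: indicator_def add.commute)
  show "(LINT t:{a..b}|lebesgue. f (t + s)) = (LINT t:{a+s..b+s}|lebesgue. f t)"
    unfolding set_lebesgue_integral_def
    by (subst (2) lebesgue_integral_real_affine[of 1 _ s]) (simp_all only: eq, simp)
  show "set_integrable lebesgue {a..b} (\<lambda>t. f (t + s)) \<longleftrightarrow> set_integrable lebesgue {a+s..b+s} f"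
    unfolding set_integrable_def
    using lebesgue_integrable_real_affine_iff[of 1 "\<lambda>t. indicat_real {a+s..b+s} t *\<^sub>R f t" s]
    by (simp only: eq)
qed

lemma set_integral_flip:
  fixes f :: "real \<Rightarrow> real"
  shows "(LINT t:{a..b}|lebesgue. f (s - t)) = (LINT t:{s-b..s-a}|lebesgue. f t)"
    and "set_integrable lebesgue {a..b} (\<lambda>t. f (s - t)) \<longleftrightarrow> set_integrable lebesgue {s-b..s-a} f"
proof -
  have eq: "indicat_real {s-b..s-a} (s + (-1) * t) *\<^sub>R f (s + (-1) * t) = indicat_real {a..b} t *\<^sub>R f (s - t)" for t
    by (auto simp: indicator_def)
  show "(LINT t:{a..b}|lebesgue. f (s - t)) = (LINT t:{s-b..s-a}|lebesgue. f t)"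
    unfolding set_lebesgue_integral_def
    by (subst (2) lebesgue_integral_real_affine[of "-1" _ s]) (simp_all only: eq, simp)
  show "set_integrable lebesgue {a..b} (\<lambda>t. f (s - t)) \<longleftrightarrow> set_integrable lebesgue {s-b..s-a} f"
    unfolding set_integrable_def
    using lebesgue_integrable_real_affine_iff[of "-1" "\<lambda>t. indicat_real {s-b..s-a} t *\<^sub>R f t" s]
    by (simp only: eq)
qed

lemma set_integral_Icc_combine:
  fixes f :: "real \<Rightarrow> real"
  assumes "set_integrable lebesgue {a..b} f" "a \<le> c" "c \<le> b"
  shows "(LINT t:{a..b}|lebesgue. f t) = (LINT t:{a..c}|lebesgue. f t) + (LINT t:{c..b}|lebesgue. f t)"
proof -
  have "set_integrable lebesgue {a..c} f" "set_integrable lebesgue {c..b} f"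
    using assms by (auto intro: set_integrable_subset)
  then show ?thesis
    using assms Henstock_Kurzweil_Integration.integral_combine[of a c b f]
    by (simp add: set_lebesgue_integral_eq_integral)
qed

lemma periodic_set_integrable:
  fixes f :: "real \<Rightarrow> real"
  assumes per: "periodic_2pi f" and int: "set_integrable lebesgue {0..2*pi} f"
  shows "set_integrable lebesgue {a..b} f"
proof -
  have sh: "set_integrable lebesgue {2*pi* of_int j..2*pi + 2*pi* of_int j} f" for j
    using set_integral_shift(2)[of 0 "2*pi" f "2*pi* of_int j"] int
    by (simp add: periodic_2pi_int[OF per])
  have "set_integrable lebesgue {- 2*pi * real m..2*pi * real m} f" for m
  proof (induction m)
    case 0
    have "set_integrable lebesgue {0..0} f" by (rule set_integrable_subset[OF int]) auto
    then show ?case by simp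
  next
    case (Suc m)
    have "{- 2*pi * real (Suc m)..2*pi * real (Suc m)} =
      {- 2*pi * real m..2*pi * real m} \<union> {2*pi* of_int (int m)..2*pi + 2*pi* of_int (int m)}
       \<union> {2*pi* of_int (- int m - 1)..2*pi + 2*pi* of_int (- int m - 1)}"
    proof -
      define M where "M = 2*pi * real m"
      have "M \<ge> 0" by (simp add: M_def)
      then have "{- 2*pi - M..M + 2*pi} = {-M..M} \<union> {M..2*pi + M} \<union> {-M - 2*pi..- M}"
        using pi_gt_zero by (auto simp del: pi_gt_zero)
      then show ?thesis by (simp add: M_def algebra_simps)
    qed
    then show ?case using Suc sh[of m] sh[of "- int m - 1"]
      by (simp only:) (intro set_integrable_Un; simp)
  qed
  note this[of "nat \<lceil>max \<bar>a\<bar> \<bar>b\<bar>\<rceil>"]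
  moreover have "{a..b} \<subseteq> {- 2*pi * real (nat \<lceil>max \<bar>a\<bar> \<bar>b\<bar>\<rceil>)..2*pi * real (nat \<lceil>max \<bar>a\<bar> \<bar>b\<bar>\<rceil>)}"
  proof -
    define m where "m = real (nat \<lceil>max \<bar>a\<bar> \<bar>b\<bar>\<rceil>)"
    have "max \<bar>a\<bar> \<bar>b\<bar> \<le> m" unfolding m_def by linarith
    moreover have "m \<le> 2*pi*m"
      using mult_right_mono[of 1 "2*pi" m] pi_gt3 by (simp add: m_def)
    ultimately show ?thesis unfolding m_def[symmetric] by auto
  qed
  ultimately show ?thesis by - (erule set_integrable_subset, simp_all)
qed

lemma periodic_set_integral:
  fixes f :: "real \<Rightarrow> real"
  assumes per: "periodic_2pi f" and int: "set_integrable lebesgue {0..2*pi} f"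
  shows "(LINT t:{a..a+2*pi}|lebesgue. f t) = (LINT t:{0..2*pi}|lebesgue. f t)"
proof -
  define j where "j = \<lfloor>a / (2*pi)\<rfloor>"
  define r where "r = a - 2*pi*j"
  have I: "set_integrable lebesgue {a..b} f" for a b by (rule periodic_set_integrable[OF per int])
  have "of_int j \<le> a / (2*pi)" "a / (2*pi) < of_int j + 1" unfolding j_def by linarith+
  then have r: "0 \<le> r" "r \<le> 2*pi" by (auto simp: r_def field_simps)
  have "(LINT t:{a..a+2*pi}|lebesgue. f t) = (LINT t:{r..r+2*pi}|lebesgue. f t)"
    using set_integral_shift(1)[of r "r+2*pi" f "2*pi*j"]
    by (simp add: periodic_2pi_int[OF per] r_def)
  also have "\<dots> = (LINT t:{r..2*pi}|lebesgue. f t) + (LINT t:{0+2*pi..r+2*pi}|lebesgue. f t)"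
    using set_integral_Icc_combine[OF I, of r "2*pi" "r+2*pi"] r by simp
  also have "(LINT t:{0+2*pi..r+2*pi}|lebesgue. f t) = (LINT t:{0..r}|lebesgue. f t)"
    using set_integral_shift(1)[of 0 r f "2*pi"] per by (simp add: periodic_2pi_def)
  also have "(LINT t:{r..2*pi}|lebesgue. f t) + (LINT t:{0..r}|lebesgue. f t) = (LINT t:{0..2*pi}|lebesgue. f t)"
    using set_integral_Icc_combine[OF I, of 0 r "2*pi"] r by simp
  finally show ?thesis .
qed

lemma L1_per_integrable: "f \<in> L1_per \<Longrightarrow> set_integrable lebesgue {a..b} f"
  by (auto simp: L1_per_def intro: periodic_set_integrable)

lemma L1_per_shift: "f \<in> L1_per \<Longrightarrow> (\<lambda>t. f (t + s)) \<in> L1_per"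
  using L1_per_integrable[of f] set_integral_shift(2)[of 0 "2*pi" f s]
  by (auto simp: L1_per_def periodic_2pi_def algebra_simps) (metis add.assoc add.commute)

lemma L1_per_integral: "f \<in> L1_per \<Longrightarrow> (LINT t:{a..a+2*pi}|lebesgue. f t) = (LINT t:{0..2*pi}|lebesgue. f t)"
  by (auto simp: L1_per_def intro: periodic_set_integral)

lemma L1_per_integral_shift:
  "f \<in> L1_per \<Longrightarrow> (LINT t:{0..2*pi}|lebesgue. f (t + s)) = (LINT t:{0..2*pi}|lebesgue. f t)"
  using set_integral_shift(1)[of 0 "2*pi" f s] L1_per_integral[of f s] by (simp add: add.commute)

lemma L1_per_integral_reflect:
  "f \<in> L1_per \<Longrightarrow> (LINT t:{0..2*pi}|lebesgue. f (- t)) = (LINT t:{0..2*pi}|lebesgue. f t)"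
  using set_integral_flip(1)[of 0 "2*pi" f 0] L1_per_integral[of f "-2*pi"] by simp

section \<open>The functions M as sums of moving averages of the kernel\<close>

definition arc_mean :: "(real \<Rightarrow> real) \<Rightarrow> real \<Rightarrow> real \<Rightarrow> real \<Rightarrow> real" where
  "arc_mean K h x u = 1 / (2*h) * (LINT t:{x - h..x + h}|lebesgue. K (t - u))"

lemma continuous_moving_integral:
  assumes K: "K \<in> L1_per" and ab: "a \<le> b"
  shows "continuous_on UNIV (\<lambda>u. LINT t:{a..b}|lebesgue. K (t - u))"
proof -
  have "isCont (\<lambda>u. LINT t:{a..b}|lebesgue. K (t - u)) u0" for u0
  proof -
    define L where "L = a - u0 - 1"
    define R where "R = b - u0 + 1"
    define I where "I x = integral {L..x} K" for x
    have int: "K integrable_on {p..q}" for p q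
      using L1_per_integrable[OF K, of p q] by (simp add: set_lebesgue_integral_eq_integral)
    have cI: "continuous_on {L..R} I" unfolding I_def
      by (rule indefinite_integral_continuous_1[OF int])
    have eq: "(LINT t:{a..b}|lebesgue. K (t - u)) = I (b - u) - I (a - u)" if "u \<in> {u0-1<..<u0+1}" for u
    proof -
      have "(LINT t:{a..b}|lebesgue. K (t - u)) = (LINT t:{a-u..b-u}|lebesgue. K t)"
        using set_integral_shift(1)[of a b K "-u"] by simp
      also have "\<dots> = integral {a-u..b-u} K"
        by (simp add: set_lebesgue_integral_eq_integral L1_per_integrable[OF K])
      also have "\<dots> = I (b - u) - I (a - u)"
        using Henstock_Kurzweil_Integration.integral_combine[of L "a-u" "b-u" K] int ab that
        by (simp add: I_def L_def)
      finally show ?thesis .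
    qed
    have "continuous_on {u0-1<..<u0+1} (\<lambda>u. I (b - u) - I (a - u))"
      by (intro continuous_intros continuous_on_compose2[OF cI]) (use ab in \<open>auto simp: L_def R_def\<close>)
    then have "continuous_on {u0-1<..<u0+1} (\<lambda>u. LINT t:{a..b}|lebesgue. K (t - u))"
      by (subst continuous_on_cong[OF refl eq])
    then show ?thesis by (simp add: continuous_on_eq_continuous_at)
  qed
  then show ?thesis by (simp add: continuous_on_eq_continuous_at)
qed

lemma arc_mean_continuous: "K \<in> L1_per \<Longrightarrow> h > 0 \<Longrightarrow> continuous_on UNIV (arc_mean K h x)"
  unfolding arc_mean_def by (intro continuous_intros continuous_moving_integral) auto

lemma arc_mean_shift: "arc_mean K h (x + s) u = arc_mean K h x (u - s)"
  using set_integral_shift(1)[of "x-h" "x+h" "\<lambda>t. K (t - u)" s]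
  by (simp add: arc_mean_def algebra_simps)

lemma arc_mean_periodic: "K \<in> L1_per \<Longrightarrow> periodic_2pi (arc_mean K h x)"
proof -
  assume "K \<in> L1_per"
  then have "K (t - (u + 2*pi)) = K (t - u)" for t u
    using periodic_2pi_int[of K "t - u" "-1"] by (simp add: L1_per_def algebra_simps)
  then show ?thesis by (simp add: periodic_2pi_def arc_mean_def)
qed

lemma arcs_measurable [measurable]: "arcs h x \<in> sets borel"
  unfolding arcs_def by measurable

text \<open>Over the period that starts at \<open>x - h\<close> the lifted arc is a single interval, up to its
  end points.\<close>

lemma integral_over_arcs:
  assumes K: "K \<in> L1_per" and h: "0 < h" "h < pi"
  shows "(LINT t:{0..2*pi}|lebesgue. K t * indicat_real (arcs h x) t) = (LINT t:{x-h..x+h}|lebesgue. K t)"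
    and "set_integrable lebesgue {0..2*pi} (\<lambda>t. K t * indicat_real (arcs h x) t)"
proof -
  define p where "p t = K t * indicat_real (arcs h x) t" for t
  have "set_integrable lebesgue {0..2*pi} p"
    unfolding set_integrable_def p_def
  proof (rule Bochner_Integration.integrable_bound)
    show "integrable lebesgue (\<lambda>t. indicat_real {0..2*pi} t *\<^sub>R K t)"
      using L1_per_integrable[OF K] by (simp add: set_integrable_def)
    then have m: "(\<lambda>t. indicat_real {0..2*pi} t * K t) \<in> borel_measurable lebesgue"
      by (auto dest: borel_measurable_integrable)
    have "(\<lambda>t. (indicat_real {0..2*pi} t * K t) * indicat_real (arcs h x) t) \<in> borel_measurable lebesgue"
      by (intro borel_measurable_times m borel_measurable_indicator) (simp add: arcs_measurable)
    then show "(\<lambda>t. indicat_real {0..2*pi} t *\<^sub>R (K t * indicat_real (arcs h x) t)) \<in> borel_measurable lebesgue"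
      by (simp add: mult.assoc)
  qed (auto simp: indicator_def)
  then show int: "set_integrable lebesgue {0..2*pi} (\<lambda>t. K t * indicat_real (arcs h x) t)"
    by (simp add: p_def[abs_def])
  have per: "periodic_2pi p"
    using K by (auto simp: p_def periodic_2pi_def L1_per_def indicator_def arcs_periodic)
  have "(LINT t:{0..2*pi}|lebesgue. p t) = (LINT t:{x-h..x-h+2*pi}|lebesgue. p t)"
    by (rule periodic_set_integral[OF per, symmetric]) (use int in \<open>simp add: p_def[abs_def]\<close>)
  also have "\<dots> = (LINT t:{x-h..x+h}|lebesgue. K t)"
    unfolding set_lebesgue_integral_def
  proof (rule integral_discrete_difference[of "{x-h, x+h}"])
    fix t assume t: "t \<notin> {x-h, x+h}"
    have "t \<in> arcs h x \<longleftrightarrow> t < x + h" if r: "x-h \<le> t" "t \<le> x-h+2*pi"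
    proof
      assume "t \<in> arcs h x"
      then obtain j :: int where j: "\<bar>t - x - 2*pi*j\<bar> < h" by (auto simp: mem_arcs)
      then have "2*pi*j < 2*pi*1" "2*pi*(-1) < 2*pi*j" using r h unfolding abs_less_iff by linarith+
      then have "real_of_int j < 1" "-1 < real_of_int j"
        using mult_less_cancel_left_pos[of "2*pi"] pi_gt_zero by (blast intro: mult_pos_pos zero_less_numeral)+
      then have "j = 0" by linarith
      then show "t < x + h" using j by auto
    next
      assume "t < x + h"
      then show "t \<in> arcs h x" using r t unfolding mem_arcs by (intro exI[of _ 0]) auto
    qed
    then show "indicat_real {x-h..x-h+2*pi} t *\<^sub>R p t = indicat_real {x-h..x+h} t *\<^sub>R K t"
      using t h by (auto simp: p_def indicator_def)
  qed auto
  finally show "(LINT t:{0..2*pi}|lebesgue. K t * indicat_real (arcs h x) t) = (LINT t:{x-h..x+h}|lebesgue. K t)"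
    by (simp add: p_def)
qed

lemma H_fun_integral:
  assumes K: "K \<in> L1_per" and h: "0 < h" "h < pi"
  shows "(LINT t:{0..2*pi}|lebesgue. K t * H_fun n h c x t) =
          (\<Sum>k=1..n. c k * (1 / (2*h) * (LINT t:{x k - h..x k + h}|lebesgue. K t)))"
    and "set_integrable lebesgue {0..2*pi} (\<lambda>t. K t * H_fun n h c x t)"
proof -
  have eq: "K t * H_fun n h c x t = (\<Sum>k=1..n. c k / (2*h) * (K t * indicat_real (arcs h (x k)) t))" for t
    unfolding H_fun_arcs sum_distrib_left by (intro sum.cong) simp_all
  note [simp] = integral_over_arcs[OF K h]
  have i: "integrable lebesgue (\<lambda>t. indicat_real {0..2*pi} t * (c k / (2*h) * (K t * indicat_real (arcs h (x k)) t)))" for k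
  proof -
    have "set_integrable lebesgue {0..2*pi} (\<lambda>t. c k / (2*h) * (K t * indicat_real (arcs h (x k)) t))"
      by (intro set_integrable_mult_right integral_over_arcs(2)[OF K h])
    then show ?thesis by (simp only: set_integrable_def real_scaleR_def)
  qed
  show "set_integrable lebesgue {0..2*pi} (\<lambda>t. K t * H_fun n h c x t)"
    unfolding eq set_integrable_def by (simp only: real_scaleR_def sum_distrib_left) (intro Bochner_Integration.integrable_sum i)
  have "(LINT t:{0..2*pi}|lebesgue. K t * H_fun n h c x t)
      = (\<Sum>k=1..n. (LINT t:{0..2*pi}|lebesgue. c k / (2*h) * (K t * indicat_real (arcs h (x k)) t)))"
    unfolding eq set_lebesgue_integral_def real_scaleR_def sum_distrib_left
    by (rule Bochner_Integration.integral_sum) (rule i)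
  also have "\<dots> = (\<Sum>k=1..n. c k * (1 / (2*h) * (LINT t:{x k - h..x k + h}|lebesgue. K t)))"
    by (simp only: set_integral_mult_right integral_over_arcs(1)[OF K h]) simp
  finally show "(LINT t:{0..2*pi}|lebesgue. K t * H_fun n h c x t) =
          (\<Sum>k=1..n. c k * (1 / (2*h) * (LINT t:{x k - h..x k + h}|lebesgue. K t)))" .
qed

text \<open>Each coefficient enters through a moving average of \<open>K\<close>. From here continuity,
  periodicity and translation behaviour of \<^const>\<open>M_fun\<close> are inherited from those averages.\<close>

lemma M_fun_eq:
  assumes K: "K \<in> L1_per" and h: "0 < h" "h < pi"
  shows "M_fun K n h c x u = (LINT t:{0..2*pi}|lebesgue. K t) - (\<Sum>k=1..n. c k * arc_mean K h (x k) u)"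
proof -
  have Ku: "(\<lambda>t. K (t - u)) \<in> L1_per" using L1_per_shift[OF K, of "-u"] by simp
  have "M_fun K n h c x u = (LINT t:{0..2*pi}|lebesgue. K (t - u) - K (t - u) * H_fun n h c x t)"
    by (simp add: M_fun_def algebra_simps)
  also have "\<dots> = (LINT t:{0..2*pi}|lebesgue. K (t - u)) - (LINT t:{0..2*pi}|lebesgue. K (t - u) * H_fun n h c x t)"
    by (intro set_integral_diff L1_per_integrable[OF Ku] H_fun_integral(2)[OF Ku h])
  finally show ?thesis
    using H_fun_integral(1)[OF Ku h, of n c x] L1_per_integral_shift[OF K, of "-u"]
    by (simp add: arc_mean_def)
qed

lemma M_fun_continuous:
  assumes K: "K \<in> L1_per" and h: "0 < h" "h < pi"
  shows "continuous_on UNIV (M_fun K n h c x)"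
  unfolding M_fun_eq[OF assms, abs_def] by (intro continuous_intros arc_mean_continuous K h)

lemma M_fun_periodic:
  assumes K: "K \<in> L1_per" and h: "0 < h" "h < pi"
  shows "periodic_2pi (M_fun K n h c x)"
  using arc_mean_periodic[OF K] unfolding M_fun_eq[OF assms, abs_def] by (simp add: periodic_2pi_def)

lemma M_fun_shift:
  assumes K: "K \<in> L1_per" and h: "0 < h" "h < pi"
  shows "M_fun K n h c (\<lambda>k. x k + s) u = M_fun K n h c x (u - s)"
  by (simp add: M_fun_eq[OF assms] arc_mean_shift)

text \<open>Translation by \<open>2*pi/n\<close> shifts the index of every node by one, and the node that drops out
  agrees modulo the period with the one that comes in.\<close>

lemma equi_M_period:
  assumes K: "K \<in> L1_per" and h: "0 < h" "h < pi" and n: "n \<ge> 1"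
  shows "equi_M K n h lam (u + 2*pi/n) = equi_M K n h lam u"
proof -
  define A where "A k = arc_mean K h (2 * real k * pi / real n) u" for k :: nat
  have "arc_mean K h (equi_nodes n (Suc k)) (u + 2*pi/n) = A k" for k
    using arc_mean_shift[of K h "2 * real k * pi / real n" "2*pi/n" "u + 2*pi/n"] n
    by (simp add: A_def equi_nodes_def field_simps)
  then have "(\<Sum>k=1..n. arc_mean K h (equi_nodes n k) (u + 2*pi/n)) = (\<Sum>k<n. A k)"
    by (simp add: sum.atLeast1_atMost_eq)
  moreover have "A n = A 0"
    using arc_mean_shift[of K h 0 "2*pi" u] n arc_mean_periodic[OF K, of h 0]
    by (simp add: A_def periodic_2pi_def) (metis diff_add_cancel)
  then have "(\<Sum>k<n. A k) = (\<Sum>k=1..n. A k)"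
    using sum.lessThan_Suc_shift[of A n] sum.lessThan_Suc[of A n]
    by (simp add: sum.atLeast1_atMost_eq)
  ultimately show ?thesis
    by (simp add: M_fun_eq[OF K h] A_def equi_nodes_def flip: sum_distrib_left)
qed

section \<open>The remainder as an integral against M\<close>

lemma AE_lebesgue_affine:
  fixes f g :: "real \<Rightarrow> real"
  assumes c: "c \<noteq> 0" and [measurable]: "f \<in> borel_measurable lebesgue" "g \<in> borel_measurable lebesgue"
    and ae: "AE x in lebesgue. f x = g x"
  shows "AE x in lebesgue. f (s + c * x) = g (s + c * x)"
proof -
  have T: "(\<lambda>x. s + c * x) \<in> lebesgue \<rightarrow>\<^sub>M lebesgue"
    using lebesgue_affine_measurable[where c= "\<lambda>x::real. c"] c by simp
  have "AE x in density (distr lebesgue lebesgue (\<lambda>x. s + c * x)) (\<lambda>_. ennreal \<bar>c\<bar>). f x = g x"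
    using ae by (subst lebesgue_real_affine[OF c, symmetric])
  then have "AE x in distr lebesgue lebesgue (\<lambda>x. s + c * x). f x = g x"
    using c by (subst (asm) AE_density) auto
  moreover have "{x \<in> space lebesgue. f x = g x} \<in> sets lebesgue" by measurable
  ultimately show ?thesis by (subst (asm) AE_distr_iff[OF T]) auto
qed

lemma Borel_representative:
  fixes f :: "real \<Rightarrow> real"
  assumes "integrable lebesgue f"
  obtains g where "g \<in> borel_measurable borel" "integrable lborel g" "AE x in lebesgue. f x = g x"
proof -
  have "f \<in> borel_measurable (completion lborel)" using assms by auto
  then obtain g where g: "g \<in> borel_measurable lborel" "AE x in lborel. f x = g x"
    using completion_ex_borel_measurable_real by blast
  then have ae: "AE x in lebesgue. f x = g x" by (simp add: AE_completion)
  have gl: "g \<in> borel_measurable lebesgue" using g by (simp add: measurable_completion)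
  have "integrable lebesgue g"
    using assms integrable_cong_AE[OF _ gl ae] by (simp add: borel_measurable_integrable)
  then have "integrable lborel g" using g by (simp add: integrable_completion)
  then show ?thesis using that g ae by auto
qed

text \<open>For Lebesgue measurable \<open>K\<close> the function \<open>(x, t) \<mapsto> K (x - t)\<close> need not be measurable for the
  product of two Lebesgue \<open>\<sigma>\<close>-algebras. So \<open>K\<close> and \<open>\<phi>\<close> are first cut off to bounded intervals
  and replaced by almost everywhere equal Borel functions; Fubini's theorem then applies on the
  plane.\<close>

lemma conv_per_integral:
  assumes K: "K \<in> L1_per" and \<phi>: "\<phi> \<in> L1_per"
  shows "set_integrable lebesgue {a..b} (conv_per K \<phi>)"
    and "(LINT x:{a..b}|lebesgue. conv_per K \<phi> x) =
         (LINT t:{0..2*pi}|lebesgue. \<phi> t * (LINT x:{a..b}|lebesgue. K (x - t)))"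
proof -
  \<comment> \<open>For \<open>x \<in> {a..b}\<close> and \<open>t \<in> {0..2*pi}\<close> only the values of \<open>K\<close> on \<open>{a - 2*pi..b}\<close> enter.\<close>
  define K0 where "K0 t = indicat_real {a - 2*pi..b} t *\<^sub>R K t" for t
  define \<phi>0 where "\<phi>0 t = indicat_real {0..2*pi} t *\<^sub>R \<phi> t" for t
  have "integrable lebesgue K0" "integrable lebesgue \<phi>0"
    using L1_per_integrable[OF K] L1_per_integrable[OF \<phi>]
    by (simp_all add: K0_def[abs_def] \<phi>0_def[abs_def] set_integrable_def)
  then have K0m[measurable]: "K0 \<in> borel_measurable lebesgue" and \<phi>0m[measurable]: "\<phi>0 \<in> borel_measurable lebesgue"
    by auto
  obtain K' where K'm[measurable]: "K' \<in> borel_measurable borel" and K'i: "integrable lborel K'"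
    and K'ae: "AE x in lebesgue. K0 x = K' x"
    using Borel_representative[OF \<open>integrable lebesgue K0\<close>] .
  obtain \<phi>' where \<phi>'m[measurable]: "\<phi>' \<in> borel_measurable borel" and \<phi>'i: "integrable lborel \<phi>'"
    and \<phi>'ae: "AE x in lebesgue. \<phi>0 x = \<phi>' x"
    using Borel_representative[OF \<open>integrable lebesgue \<phi>0\<close>] .
  have K'l: "K' \<in> borel_measurable lebesgue" and \<phi>'l: "\<phi>' \<in> borel_measurable lebesgue"
    by (simp_all add: measurable_completion)
  have lb: "f \<in> borel_measurable lebesgue" if "f \<in> borel_measurable borel" for f :: "real \<Rightarrow> real"
    using that by (simp add: measurable_completion)
  have K0aff: "(\<lambda>x. K0 (s + c * x)) \<in> borel_measurable lebesgue" if "c \<noteq> 0" for s c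
    using measurable_compose[OF _ K0m, of "\<lambda>x. s + c * x" lebesgue]
      lebesgue_affine_measurable[where c= "\<lambda>x::real. c" and t = s] that by simp
  define f where "f t x = indicat_real {a..b} x * (K' (x - t) * \<phi>' t)" for t x
  have fm[measurable]: "(\<lambda>(t, x). f t x) \<in> borel_measurable (lborel \<Otimes>\<^sub>M lborel)"
    unfolding f_def by measurable
  define g where "g t x = K' (x - t) * \<phi>' t" for t x
  have gm[measurable]: "(\<lambda>(t, x). g t x) \<in> borel_measurable (lborel \<Otimes>\<^sub>M lborel)"
    unfolding g_def by measurable
  have K't: "integrable lborel (\<lambda>x. K' (x - t))" for t
    using lborel_integrable_real_affine[OF K'i, of 1 "-t"] by simp
  have K'n: "(LINT x|lborel. \<bar>K' (x - t)\<bar>) = (LINT x|lborel. \<bar>K' x\<bar>)" for t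
    using lborel_integral_real_affine[of 1 "\<lambda>x. \<bar>K' x\<bar>" "-t"] by simp
  have "integrable (lborel \<Otimes>\<^sub>M lborel) (\<lambda>(t, x). g t x)"
  proof (rule lborel_pair.Fubini_integrable[OF gm])
    show "integrable lborel (\<lambda>t. LINT x|lborel. norm (case (t, x) of (t, x) \<Rightarrow> g t x))"
      using \<phi>'i by (simp add: g_def abs_mult K'n)
    show "AE t in lborel. integrable lborel (\<lambda>x. case (t, x) of (t, x) \<Rightarrow> g t x)"
      using K't by (simp add: g_def)
  qed
  then have fi: "integrable (lborel \<Otimes>\<^sub>M lborel) (\<lambda>(t, x). f t x)"
    by (rule Bochner_Integration.integrable_bound) (auto simp: f_def g_def indicator_def)
  have fx: "(LINT t|lborel. f t x) = indicat_real {a..b} x * conv_per K \<phi> x" for x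
  proof (cases "x \<in> {a..b}")
    case True
    have "conv_per K \<phi> x = (LINT t|lebesgue. K0 (x + (-1) * t) * \<phi>0 t)"
      unfolding conv_per_def set_lebesgue_integral_def
      by (intro Bochner_Integration.integral_cong refl) (use True in \<open>auto simp: K0_def \<phi>0_def indicator_def\<close>)
    also have "\<dots> = (LINT t|lebesgue. K' (x + (-1) * t) * \<phi>' t)"
    proof (rule integral_cong_AE)
      show "AE t in lebesgue. K0 (x + (-1) * t) * \<phi>0 t = K' (x + (-1) * t) * \<phi>' t"
        using AE_lebesgue_affine[OF _ K0m K'l K'ae, of "-1" x] \<phi>'ae by auto
      show "(\<lambda>t. K0 (x + (-1) * t) * \<phi>0 t) \<in> borel_measurable lebesgue"
        by (intro borel_measurable_times K0aff \<phi>0m) simp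
      show "(\<lambda>t. K' (x + (-1) * t) * \<phi>' t) \<in> borel_measurable lebesgue"
        by (rule lb) measurable
    qed
    also have "\<dots> = (LINT t|lborel. K' (x + (-1) * t) * \<phi>' t)"
      by (rule integral_completion) measurable
    finally show ?thesis using True by (simp add: f_def)
  qed (simp add: f_def)
  have fe: "(LINT x|lborel. f t x) = \<phi>' t * (LINT x|lborel. indicat_real {a..b} x * K' (x - t))" for t
  proof -
    have "f t x = \<phi>' t * (indicat_real {a..b} x * K' (x - t))" for x by (simp add: f_def)
    then show ?thesis by simp
  qed
  have ft: "indicat_real {0..2*pi} t * (LINT x|lborel. f t x) =
      indicat_real {0..2*pi} t * (\<phi>' t * (LINT x:{a..b}|lebesgue. K (x - t)))" for t
  proof (cases "t \<in> {0..2*pi}")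
    case True
    have "(LINT x:{a..b}|lebesgue. K (x - t)) = (LINT x|lebesgue. indicat_real {a..b} x * K0 (- t + 1 * x))"
      unfolding set_lebesgue_integral_def
      by (intro Bochner_Integration.integral_cong refl) (use True in \<open>auto simp: K0_def indicator_def\<close>)
    also have "\<dots> = (LINT x|lebesgue. indicat_real {a..b} x * K' (- t + 1 * x))"
    proof (rule integral_cong_AE)
      show "AE x in lebesgue. indicat_real {a..b} x * K0 (- t + 1 * x) = indicat_real {a..b} x * K' (- t + 1 * x)"
        using AE_lebesgue_affine[OF _ K0m K'l K'ae, of "1" "-t"] by auto
      show "(\<lambda>x. indicat_real {a..b} x * K0 (- t + 1 * x)) \<in> borel_measurable lebesgue"
        by (intro borel_measurable_times K0aff borel_measurable_indicator) simp_all
      show "(\<lambda>x. indicat_real {a..b} x * K' (- t + 1 * x)) \<in> borel_measurable lebesgue"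
        by (rule lb) measurable
    qed
    also have "\<dots> = (LINT x|lborel. indicat_real {a..b} x * K' (- t + 1 * x))"
      by (rule integral_completion) measurable
    finally show ?thesis by (simp add: fe)
  qed simp
  have "integrable lborel (\<lambda>x. LINT t|lborel. f t x)"
    by (rule lborel_pair.integrable_snd[OF fi])
  then have "integrable lborel (\<lambda>x. indicat_real {a..b} x * conv_per K \<phi> x)" by (simp add: fx)
  then have cm: "(\<lambda>x. indicat_real {a..b} x * conv_per K \<phi> x) \<in> borel_measurable lborel"
    and ci: "integrable lebesgue (\<lambda>x. indicat_real {a..b} x * conv_per K \<phi> x)"
    by (auto simp: integrable_completion borel_measurable_integrable)
  show "set_integrable lebesgue {a..b} (conv_per K \<phi>)"
    using ci by (simp add: set_integrable_def)
  have nz: "AE t in lborel. \<phi>' t = indicat_real {0..2*pi} t * \<phi>' t"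
  proof -
    have "AE t in lebesgue. \<phi>' t = indicat_real {0..2*pi} t * \<phi>' t"
      using \<phi>'ae
    proof eventually_elim
      case (elim t)
      then show ?case by (cases "t \<in> {0..2*pi}") (simp_all add: \<phi>0_def)
    qed
    then show ?thesis by (simp add: AE_completion_iff)
  qed
  have "(LINT x:{a..b}|lebesgue. conv_per K \<phi> x) = (LINT x|lborel. indicat_real {a..b} x * conv_per K \<phi> x)"
    unfolding set_lebesgue_integral_def using cm by (simp add: integral_completion)
  also have "\<dots> = (LINT x|lborel. LINT t|lborel. f t x)" by (simp add: fx)
  also have "\<dots> = (LINT t|lborel. LINT x|lborel. f t x)"
    by (rule lborel_pair.Fubini_integral[OF fi])
  also have "\<dots> = (LINT t|lebesgue. LINT x|lborel. f t x)"
    by (rule integral_completion[symmetric]) measurable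
  also have "\<dots> = (LINT t|lebesgue. indicat_real {0..2*pi} t * (\<phi> t * (LINT x:{a..b}|lebesgue. K (x - t))))"
  proof (rule integral_cong_AE)
    show "(\<lambda>t. LINT x|lborel. f t x) \<in> borel_measurable lebesgue"
      by (rule lb) measurable
    have ae: "AE t in lebesgue. (LINT x|lborel. f t x) = indicat_real {0..2*pi} t * (LINT x|lborel. f t x)"
      using \<phi>'ae
    proof eventually_elim
      case (elim t)
      then show ?case by (cases "t \<in> {0..2*pi}") (simp_all add: fe \<phi>0_def)
    qed
    show "AE t in lebesgue. (LINT x|lborel. f t x) =
        indicat_real {0..2*pi} t * (\<phi> t * (LINT x:{a..b}|lebesgue. K (x - t)))"
      using ae \<phi>'ae
    proof eventually_elim
      case (elim t)
      then show ?case using ft[of t] by (auto simp: \<phi>0_def indicator_def split: if_splits)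
    qed
    show "(\<lambda>t. indicat_real {0..2*pi} t * (\<phi> t * (LINT x:{a..b}|lebesgue. K (x - t)))) \<in> borel_measurable lebesgue"
    proof (cases "a \<le> b")
      case True
      then have "(\<lambda>t. LINT x:{a..b}|lebesgue. K (x - t)) \<in> borel_measurable lebesgue"
        by (intro lb borel_measurable_continuous_onI continuous_moving_integral K)
      then have "(\<lambda>t. \<phi>0 t * (LINT x:{a..b}|lebesgue. K (x - t))) \<in> borel_measurable lebesgue"
        by (intro borel_measurable_times) auto
      then show ?thesis by (simp add: \<phi>0_def mult.assoc)
    qed (simp add: set_lebesgue_integral_def)
  qed
  finally show "(LINT x:{a..b}|lebesgue. conv_per K \<phi> x) =
         (LINT t:{0..2*pi}|lebesgue. \<phi> t * (LINT x:{a..b}|lebesgue. K (x - t)))"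
    by (simp add: set_lebesgue_integral_def)
qed

lemma L1_per_mult_continuous_integrable:
  assumes \<phi>: "\<phi> \<in> L1_per" and F: "continuous_on UNIV F"
  shows "set_integrable lebesgue {a..b} (\<lambda>t. \<phi> t * F t)"
proof -
  have "compact (F ` {a..b})" by (intro compact_continuous_image continuous_on_subset[OF F]) auto
  then obtain B where B: "\<And>t. t \<in> {a..b} \<Longrightarrow> \<bar>F t\<bar> \<le> B"
    using compact_imp_bounded bounded_iff by (metis image_eqI real_norm_def)
  have F': "F \<in> borel_measurable lebesgue"
    using F by (simp add: measurable_completion borel_measurable_continuous_onI)
  have i: "integrable lebesgue (\<lambda>t. indicat_real {a..b} t *\<^sub>R \<phi> t)"
    using L1_per_integrable[OF \<phi>] by (simp add: set_integrable_def)
  show ?thesis unfolding set_integrable_def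
  proof (rule Bochner_Integration.integrable_bound)
    show "integrable lebesgue (\<lambda>t. B * (indicat_real {a..b} t *\<^sub>R \<phi> t))" using i by simp
    have "(\<lambda>t. (indicat_real {a..b} t *\<^sub>R \<phi> t) * F t) \<in> borel_measurable lebesgue"
      using borel_measurable_integrable[OF i] F' by (rule borel_measurable_times)
    then show "(\<lambda>t. indicat_real {a..b} t *\<^sub>R (\<phi> t * F t)) \<in> borel_measurable lebesgue"
      by (simp add: mult.assoc)
    show "AE t in lebesgue. norm (indicat_real {a..b} t *\<^sub>R (\<phi> t * F t)) \<le> norm (B * (indicat_real {a..b} t *\<^sub>R \<phi> t))"
    proof (rule AE_I2)
      fix t show "norm (indicat_real {a..b} t *\<^sub>R (\<phi> t * F t)) \<le> norm (B * (indicat_real {a..b} t *\<^sub>R \<phi> t))"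
        using B[of t] mult_left_mono[of "\<bar>F t\<bar>" "\<bar>B\<bar>" "\<bar>\<phi> t\<bar>"]
        by (auto simp: indicator_def abs_mult mult.commute)
    qed
  qed
qed

lemma quad_rem_conv:
  assumes K: "K \<in> L1_per" and \<phi>: "\<phi> \<in> L1_per" and h: "0 < h" "h < pi"
  shows "quad_rem (\<lambda>x. e + conv_per K \<phi> x) (quad n h c x) =
     e * (2*pi - (\<Sum>k=1..n. c k)) + (LINT u:{0..2*pi}|lebesgue. \<phi> u * M_fun K n h c x u)"
proof -
  let ?\<kappa> = "LINT t:{0..2*pi}|lebesgue. K t"
  let ?I = "LINT t:{0..2*pi}|lebesgue. \<phi> t"
  let ?A = "\<lambda>k. LINT u:{0..2*pi}|lebesgue. \<phi> u * arc_mean K h (x k) u"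
  have cst: "set_integrable lebesgue {a..b} (\<lambda>_. e)" for a b :: real
    by (intro absolutely_integrable_on_const) simp
  have int: "(LINT x:{a..b}|lebesgue. e + conv_per K \<phi> x) =
      e * (b - a) + (LINT t:{0..2*pi}|lebesgue. \<phi> t * (LINT x:{a..b}|lebesgue. K (x - t)))" if "a \<le> b" for a b
  proof -
    have "(LINT x:{a..b}|lebesgue. e + conv_per K \<phi> x) = (LINT x:{a..b}|lebesgue. e) + (LINT x:{a..b}|lebesgue. conv_per K \<phi> x)"
      by (rule set_integral_add(2)[OF cst conv_per_integral(1)[OF K \<phi>]])
    also have "(LINT x:{a..b}|lebesgue. e) = e * (b - a)"
      using that by (simp add: set_lebesgue_integral_def)
    finally show ?thesis using conv_per_integral(2)[OF K \<phi>] by simp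
  qed
  have 1: "(LINT x:{0..2*pi}|lebesgue. K (x - t)) = ?\<kappa>" for t
    using L1_per_integral_shift[OF K, of "-t"] by simp
  have 2: "1 / (2*h) * (LINT t:{0..2*pi}|lebesgue. \<phi> t * (LINT x:{x k-h..x k+h}|lebesgue. K (x - t))) = ?A k" for k
    by (simp only: set_integral_mult_right[symmetric] arc_mean_def mult.left_commute)
  have "c k * (1 / (2*h)) * (LINT x:{x k-h..x k+h}|lebesgue. e + conv_per K \<phi> x) = c k * e + c k * ?A k" for k
    unfolding 2[symmetric] using int[of "x k - h" "x k + h"] h by (simp add: field_simps)
  then have q: "quad n h c x (\<lambda>x. e + conv_per K \<phi> x) = e * (\<Sum>k=1..n. c k) + (\<Sum>k=1..n. c k * ?A k)"
    by (simp add: quad_def sum.distrib sum_distrib_left mult.commute)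
  have i: "set_integrable lebesgue {0..2*pi} (\<lambda>u. \<phi> u * arc_mean K h (x k) u)" for k
    by (intro L1_per_mult_continuous_integrable \<phi> arc_mean_continuous K h)
  have i2: "set_integrable lebesgue {0..2*pi} (\<lambda>u. \<Sum>k=1..n. c k * (\<phi> u * arc_mean K h (x k) u))"
    using i unfolding set_integrable_def
    by (auto simp: sum_distrib_left mult.left_commute[of _ "c _"] intro!: Bochner_Integration.integrable_sum)
  have sm: "(LINT u:{0..2*pi}|lebesgue. \<Sum>k=1..n. c k * (\<phi> u * arc_mean K h (x k) u)) = (\<Sum>k=1..n. c k * ?A k)"
    using i unfolding set_integrable_def set_lebesgue_integral_def
    by (simp add: sum_distrib_left mult.left_commute[of _ "c _"] Bochner_Integration.integral_sum)
  have "(LINT u:{0..2*pi}|lebesgue. \<phi> u * M_fun K n h c x u) =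
     (LINT u:{0..2*pi}|lebesgue. ?\<kappa> * \<phi> u - (\<Sum>k=1..n. c k * (\<phi> u * arc_mean K h (x k) u)))"
    unfolding M_fun_eq[OF K h] by (simp add: algebra_simps sum_distrib_left)
  also have "\<dots> = ?\<kappa> * ?I - (\<Sum>k=1..n. c k * ?A k)"
    by (subst set_integral_diff(2)) (use L1_per_integrable[OF \<phi>] i2 in \<open>simp_all add: sm del: One_nat_def\<close>)
  finally have M: "(LINT u:{0..2*pi}|lebesgue. \<phi> u * M_fun K n h c x u) = ?\<kappa> * ?I - (\<Sum>k=1..n. c k * ?A k)" .
  have "(LINT x:{0..2*pi}|lebesgue. e + conv_per K \<phi> x) = e * (2*pi) + ?\<kappa> * ?I"
    using int[of 0 "2*pi"] by (simp add: 1)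
  then show ?thesis
    unfolding quad_rem_def q M by (simp add: right_diff_distrib)
qed

section \<open>Kernels that do not increase the number of sign changes\<close>

lemma C_per_L1_per: "f \<in> C_per \<Longrightarrow> f \<in> L1_per"
  by (auto simp: C_per_def L1_per_def intro!: absolutely_integrable_continuous_real continuous_on_subset[of UNIV f])

lemma L1_per_mult_C_per: "\<phi> \<in> L1_per \<Longrightarrow> F \<in> C_per \<Longrightarrow> (\<lambda>t. \<phi> t * F t) \<in> L1_per"
  using L1_per_mult_continuous_integrable[of \<phi> F 0 "2*pi"]
  by (auto simp: C_per_def L1_per_def periodic_2pi_def)

text \<open>The functions \<^const>\<open>M_fun\<close> are correlations \<open>\<integral> K (t - u) \<phi> t\<close> and not convolutions; the
  two differ by reflections of argument and result, which preserve sign changes.\<close>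

lemma CVD_kernel_correlation:
  assumes CVD: "CVD_kernel K" and \<phi>: "\<phi> \<in> C_per" and perp: "perp \<phi> (mu K)"
  shows "sign_changes (\<lambda>u. a * mu K + (LINT t:{0..2*pi}|lebesgue. K (t - u) * \<phi> t)) \<le> sign_changes \<phi>"
proof -
  have K: "K \<in> L1_per" using CVD by (simp add: CVD_kernel_def)
  define \<psi> where "\<psi> t = \<phi> (- t)" for t
  have "\<psi> \<in> C_per"
  proof -
    have "continuous_on UNIV \<psi>" unfolding \<psi>_def
      by (rule continuous_on_compose2[of UNIV \<phi>]) (use \<phi> in \<open>auto simp: C_per_def intro: continuous_intros\<close>)
    moreover have "periodic_2pi \<psi>"
    proof -
      have "periodic_2pi \<phi>" using \<phi> by (simp add: C_per_def)
      from periodic_2pi_int[OF this, of "- t" "-1" for t] show ?thesis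
        by (simp add: periodic_2pi_def \<psi>_def)
    qed
    ultimately show ?thesis by (simp add: C_per_def)
  qed
  moreover have "perp \<psi> (mu K)"
    using L1_per_integral_reflect[OF C_per_L1_per[OF \<phi>]] perp by (simp add: perp_def \<psi>_def)
  ultimately have le: "sign_changes (\<lambda>x. a * mu K + conv_per K \<psi> x) \<le> sign_changes \<psi>"
    using CVD by (simp add: CVD_kernel_def)
  have conv: "conv_per K \<psi> (- u) = (LINT t:{0..2*pi}|lebesgue. K (t - u) * \<phi> t)" for u
  proof -
    have "(\<lambda>t. K (t - u) * \<phi> t) \<in> L1_per"
      using L1_per_mult_C_per[OF L1_per_shift[OF K, of "-u"] \<phi>] by simp
    from L1_per_integral_reflect[OF this] show ?thesis
      by (simp add: conv_per_def \<psi>_def minus_diff_commute)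
  qed
  have "sign_changes (\<lambda>u. a * mu K + (LINT t:{0..2*pi}|lebesgue. K (t - u) * \<phi> t))
      = sign_changes (\<lambda>x. a * mu K + conv_per K \<psi> x)"
    unfolding conv[symmetric] by (rule sign_changes_reflect)
  also note le
  also have "sign_changes \<psi> = sign_changes \<phi>"
    unfolding \<psi>_def by (rule sign_changes_reflect)
  finally show ?thesis .
qed

text \<open>Vanishes on \<open>D\<close> and, for closed nonempty \<open>D\<close>, tends to \<open>1\<close> off \<open>D\<close> as \<open>m\<close> grows. Multiplication
  by it makes a bounded function continuous across its discontinuities in \<open>D\<close> without reversing
  any sign.\<close>

definition cutoff :: "real set \<Rightarrow> nat \<Rightarrow> real \<Rightarrow> real" where
  "cutoff D m t = min 1 (real m * infdist t D)"

lemma cutoff_bounds: "0 \<le> cutoff D m t" "cutoff D m t \<le> 1"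
  by (auto simp: cutoff_def infdist_nonneg)

lemma cutoff_continuous: "continuous_on UNIV (cutoff D m)"
  unfolding cutoff_def by (intro continuous_intros)

lemma cutoff_tendsto:
  assumes "closed D" "D \<noteq> {}" "t \<notin> D"
  shows "(\<lambda>m. cutoff D m t) \<longlonglongrightarrow> 1"
proof -
  have pos: "infdist t D > 0"
    using in_closed_iff_infdist_zero[OF assms(1,2), of t] assms(3) infdist_nonneg[of t D] by linarith
  obtain M :: nat where M: "1 < real M * infdist t D"
    using reals_Archimedean3[OF pos] by blast
  have "cutoff D m t = 1" if "m \<ge> M" for m
  proof -
    have "real M * infdist t D \<le> real m * infdist t D" using that pos by (intro mult_right_mono) auto
    then show ?thesis using M unfolding cutoff_def by linarith
  qed
  then have "eventually (\<lambda>m. cutoff D m t = 1) sequentially"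
    by (auto simp: eventually_sequentially)
  then show ?thesis by (rule tendsto_eventually)
qed

lemma cutoff_periodic:
  assumes "\<And>t. t + 2*pi \<in> D \<longleftrightarrow> t \<in> D"
  shows "periodic_2pi (cutoff D m)"
proof -
  have "D = (\<lambda>t. t + 2*pi) ` D"
  proof (intro equalityI subsetI)
    fix t assume "t \<in> D"
    then have "t - 2*pi \<in> D" using assms[of "t - 2*pi"] by simp
    then show "t \<in> (\<lambda>t. t + 2*pi) ` D" by (intro image_eqI[of _ _ "t - 2*pi"]) auto
  qed (use assms in auto)
  then have "infdist (t + 2*pi) D = infdist (t + 2*pi) ((\<lambda>t. t + 2*pi) ` D)" for t by simp
  also have "\<dots> t = infdist t D" for t
    by (auto simp: infdist_def image_image dist_real_def)
  finally show ?thesis by (simp add: periodic_2pi_def cutoff_def)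
qed

lemma cutoff_mult_continuous:
  assumes D: "closed D" and B: "\<And>t. \<bar>G t\<bar> \<le> B" and cont: "\<And>t. t \<notin> D \<Longrightarrow> isCont G t"
  shows "continuous_on UNIV (\<lambda>t. cutoff D m t * G t)"
proof -
  have "isCont (\<lambda>t. cutoff D m t * G t) t" for t
  proof (cases "t \<in> D")
    case False
    then show ?thesis
      using cont cutoff_continuous[of D m] by (auto intro!: continuous_intros simp: continuous_on_eq_continuous_at)
  next
    case True
    then have 0: "cutoff D m t = 0" by (simp add: cutoff_def)
    have "(\<lambda>s. B * cutoff D m s) \<midarrow>t\<rightarrow> B * cutoff D m t"
      using cutoff_continuous[of D m] by (intro tendsto_intros) (simp add: continuous_on_eq_continuous_at isCont_def)
    then have lim: "(\<lambda>s. B * cutoff D m s) \<midarrow>t\<rightarrow> 0" by (simp add: 0)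
    have "(\<lambda>s. cutoff D m s * G s) \<midarrow>t\<rightarrow> 0"
    proof (rule tendsto_rabs_zero_cancel, rule tendsto_sandwich[OF _ _ tendsto_const lim])
      show "\<forall>\<^sub>F s in at t. \<bar>cutoff D m s * G s\<bar> \<le> B * cutoff D m s"
        using B mult_left_mono[OF B cutoff_bounds(1)[of D m]] cutoff_bounds(1)[of D m]
        by (auto simp: abs_mult mult.commute)
    qed auto
    then show ?thesis by (simp add: isCont_def 0)
  qed
  then show ?thesis by (simp add: continuous_on_eq_continuous_at)
qed

lemma cutoff_integral_tendsto:
  fixes k :: "real \<Rightarrow> real"
  assumes D: "closed D" "D \<noteq> {}" "D \<in> null_sets lebesgue"
    and k: "set_integrable lebesgue A k"
    and G: "G \<in> borel_measurable lebesgue" and B: "\<And>t. \<bar>G t\<bar> \<le> B"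
  shows "set_integrable lebesgue A (\<lambda>t. k t * (cutoff D m t * G t))"
    and "set_integrable lebesgue A (\<lambda>t. k t * G t)"
    and "(\<lambda>m. LINT t:A|lebesgue. k t * (cutoff D m t * G t)) \<longlonglongrightarrow> (LINT t:A|lebesgue. k t * G t)"
proof -
  have wm: "cutoff D m \<in> borel_measurable lebesgue" for m
    using cutoff_continuous[of D m] by (simp add: measurable_completion borel_measurable_continuous_onI)
  have ki: "integrable lebesgue (\<lambda>t. indicat_real A t *\<^sub>R k t)" using k by (simp add: set_integrable_def)
  then have km: "(\<lambda>t. indicat_real A t *\<^sub>R k t) \<in> borel_measurable lebesgue" by auto
  have m1: "(\<lambda>t. indicat_real A t *\<^sub>R (k t * (cutoff D m t * G t))) \<in> borel_measurable lebesgue" for m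
  proof -
    have "(\<lambda>t. (indicat_real A t *\<^sub>R k t) * (cutoff D m t * G t)) \<in> borel_measurable lebesgue"
      by (intro borel_measurable_times km wm G)
    then show ?thesis by (simp add: mult.assoc)
  qed
  have m2: "(\<lambda>t. indicat_real A t *\<^sub>R (k t * G t)) \<in> borel_measurable lebesgue"
  proof -
    have "(\<lambda>t. (indicat_real A t *\<^sub>R k t) * G t) \<in> borel_measurable lebesgue"
      by (intro borel_measurable_times km G)
    then show ?thesis by (simp add: mult.assoc)
  qed
  have b2: "norm (indicat_real A t *\<^sub>R (k t * G t)) \<le> B * \<bar>indicat_real A t *\<^sub>R k t\<bar>" for t
    using mult_right_mono[OF B[of t], of "\<bar>indicat_real A t * k t\<bar>"]
    by (simp add: abs_mult mult_ac)
  have b1: "norm (indicat_real A t *\<^sub>R (k t * (cutoff D m t * G t))) \<le> B * \<bar>indicat_real A t *\<^sub>R k t\<bar>" for t m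
  proof -
    have "\<bar>cutoff D m t * G t\<bar> \<le> \<bar>G t\<bar>"
      using mult_right_mono[OF cutoff_bounds(2)[of D m t], of "\<bar>G t\<bar>"] cutoff_bounds(1)[of D m t]
      by (simp add: abs_mult)
    then have "\<bar>indicat_real A t * k t\<bar> * \<bar>cutoff D m t * G t\<bar> \<le> \<bar>indicat_real A t * k t\<bar> * \<bar>G t\<bar>"
      by (rule mult_left_mono) simp
    with b2[of t] show ?thesis by (simp add: abs_mult mult_ac)
  qed
  have bi: "integrable lebesgue (\<lambda>t. B * \<bar>indicat_real A t *\<^sub>R k t\<bar>)" using ki by (intro integrable_mult_right) auto
  have lim: "AE t in lebesgue. (\<lambda>m. indicat_real A t *\<^sub>R (k t * (cutoff D m t * G t))) \<longlonglongrightarrow> indicat_real A t *\<^sub>R (k t * G t)"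
    using AE_not_in[OF D(3)]
  proof eventually_elim
    case (elim t)
    have "(\<lambda>m. indicat_real A t *\<^sub>R (k t * (cutoff D m t * G t))) \<longlonglongrightarrow> indicat_real A t *\<^sub>R (k t * (1 * G t))"
      by (intro tendsto_intros cutoff_tendsto D elim)
    then show ?case by simp
  qed
  show "set_integrable lebesgue A (\<lambda>t. k t * (cutoff D m t * G t))"
    unfolding set_integrable_def
    by (rule integrable_dominated_convergence2[OF m1 m1 bi]) (use b1 in auto)
  show "set_integrable lebesgue A (\<lambda>t. k t * G t)"
    unfolding set_integrable_def
    by (rule integrable_dominated_convergence[OF m2 m1 bi lim]) (use b1 in auto)
  show "(\<lambda>m. LINT t:A|lebesgue. k t * (cutoff D m t * G t)) \<longlonglongrightarrow> (LINT t:A|lebesgue. k t * G t)"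
    unfolding set_lebesgue_integral_def
    by (rule integral_dominated_convergence[OF m2 m1 bi lim]) (use b1 in auto)
qed

text \<open>The CVD property for bounded functions that are continuous off a closed null set. Damped by
  \<^const>\<open>cutoff\<close>, such a \<open>g\<close> becomes continuous and takes no signs that \<open>g\<close> does not have, while
  the correlations converge pointwise by dominated convergence. Finitely many strict sign
  conditions survive the passage to an approximation. When \<open>mu K = 1\<close> the approximation must have
  mean zero, so its negative part is rescaled by a factor that tends to \<open>1\<close>.\<close>

lemma CVD_kernel_piecewise_continuous:
  assumes CVD: "CVD_kernel K"
    and per: "periodic_2pi g" and gm: "g \<in> borel_measurable lebesgue" and B: "\<And>t. \<bar>g t\<bar> \<le> B"
    and D: "closed D" "D \<noteq> {}" "D \<in> null_sets lebesgue" and Dper: "\<And>t. t + 2*pi \<in> D \<longleftrightarrow> t \<in> D"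
    and cont: "\<And>t. t \<notin> D \<Longrightarrow> isCont g t"
    and perp: "perp g (mu K)"
  shows "sign_changes (\<lambda>u. a * mu K + (LINT t:{0..2*pi}|lebesgue. K (t - u) * g t)) \<le> sign_changes g"
    (is "sign_changes ?f \<le> _")
  unfolding sign_changes_eq_Sup[of ?f]
proof (rule Sup_least, clarsimp)
  fix N y assume alt: "alternates ?f N y"
  have K: "K \<in> L1_per" using CVD by (simp add: CVD_kernel_def)
  have Ku: "set_integrable lebesgue {0..2*pi} (\<lambda>t. K (t - u))" for u
    using L1_per_integrable[OF L1_per_shift[OF K, of "-u"], of 0 "2*pi"] by simp
  define gp where "gp t = max (g t) 0" for t
  define gn where "gn t = max (- g t) 0" for t
  have g: "g t = gp t - gn t" for t by (simp add: gp_def gn_def)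
  have gpm: "gp \<in> borel_measurable lebesgue" "gn \<in> borel_measurable lebesgue"
    using gm unfolding gp_def gn_def by (auto intro!: borel_measurable_max)
  have g0: "gp t \<ge> 0" "gn t \<ge> 0" for t by (simp_all add: gp_def gn_def)
  have gB: "\<bar>gp t\<bar> \<le> B" "\<bar>gn t\<bar> \<le> B" for t using B[of t] by (auto simp: gp_def gn_def)
  have gc: "isCont gp t" "isCont gn t" if "t \<notin> D" for t
    unfolding gp_def gn_def using cont[OF that] by (auto intro!: continuous_intros)
  note lim_p = cutoff_integral_tendsto[OF D _ gpm(1) gB(1)]
  note lim_n = cutoff_integral_tendsto[OF D _ gpm(2) gB(2)]
  have one: "set_integrable lebesgue {0..2*pi} (\<lambda>_. 1::real)"
    by (intro absolutely_integrable_on_const) simp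
  define P where "P m = (LINT t:{0..2*pi}|lebesgue. cutoff D m t * gp t)" for m
  define Q where "Q m = (LINT t:{0..2*pi}|lebesgue. cutoff D m t * gn t)" for m
  have PQ: "P \<longlonglongrightarrow> (LINT t:{0..2*pi}|lebesgue. gp t)" "Q \<longlonglongrightarrow> (LINT t:{0..2*pi}|lebesgue. gn t)"
    using lim_p(3)[OF one] lim_n(3)[OF one] by (simp_all add: P_def[abs_def] Q_def[abs_def])
  have nonneg: "P m \<ge> 0" "Q m \<ge> 0" for m
    unfolding P_def Q_def set_lebesgue_integral_def
    by (intro Bochner_Integration.integral_nonneg; simp add: cutoff_bounds gp_def gn_def)+
  \<comment> \<open>For \<open>mu K = 0\<close> the factor is \<open>1\<close>. Otherwise \<open>P m / Q m\<close> restores mean zero; if the limit of \<open>Q\<close> vanishes, then \<open>g\<close> is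
    zero almost everywhere and its correlation is a constant, which does not alternate.\<close>
  obtain \<alpha> where \<alpha>: "\<And>m. \<alpha> m \<ge> 0" "\<alpha> \<longlonglongrightarrow> 1"
    and bal: "\<forall>\<^sub>F m in sequentially. mu K * (P m - \<alpha> m * Q m) = 0"
  proof (cases "mu K = 0")
    case True
    then show ?thesis by (intro that[of "\<lambda>_. 1"]) auto
  next
    case False
    then have "(LINT t:{0..2*pi}|lebesgue. g t) = 0" using perp by (simp add: perp_def)
    then have eq: "(LINT t:{0..2*pi}|lebesgue. gp t) = (LINT t:{0..2*pi}|lebesgue. gn t)"
      using set_integral_diff(2)[of lebesgue "{0..2*pi}" gp gn] lim_p(2)[OF one] lim_n(2)[OF one]
      by (simp add: g[symmetric])
    show ?thesis
    proof (cases "(LINT t:{0..2*pi}|lebesgue. gn t) = 0")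
      case False
      have "(\<lambda>m. P m / Q m) \<longlonglongrightarrow> 1" using tendsto_divide[OF PQ False] eq False by simp
      moreover have "\<forall>\<^sub>F m in sequentially. Q m \<noteq> 0" by (rule tendsto_imp_eventually_ne[OF PQ(2) False])
      then have "\<forall>\<^sub>F m in sequentially. mu K * (P m - P m / Q m * Q m) = 0"
        by eventually_elim simp
      ultimately show ?thesis using nonneg by (intro that[of "\<lambda>m. P m / Q m"]) auto
    next
      case True
      have ae: "AE t in lebesgue. indicat_real {0..2*pi} t * f t = 0"
        if "(LINT t:{0..2*pi}|lebesgue. f t) = 0" "set_integrable lebesgue {0..2*pi} f" "\<And>t. f t \<ge> 0" for f
        using that integral_nonneg_eq_0_iff_AE[of lebesgue "\<lambda>t. indicat_real {0..2*pi} t * f t"]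
        by (simp add: set_lebesgue_integral_def set_integrable_def)
      have "AE t in lebesgue. indicat_real {0..2*pi} t * gp t = 0" "AE t in lebesgue. indicat_real {0..2*pi} t * gn t = 0"
        using ae[of gp] ae[of gn] True eq lim_p(2)[OF one] lim_n(2)[OF one] g0 by simp_all
      then have "AE t in lebesgue. indicat_real {0..2*pi} t *\<^sub>R (K (t - u) * g t) = 0" for u
        by eventually_elim (auto simp: g)
      then have z: "(LINT t:{0..2*pi}|lebesgue. K (t - u) * g t) = 0" for u
        unfolding set_lebesgue_integral_def by (rule integral_eq_zero_AE)
      have "?f (y 1) * ?f (y (Suc 1)) < 0" using alt by (simp add: alternates_def)
      then have "(a * mu K) * (a * mu K) < 0" by (simp add: z)
      then show ?thesis by (simp add: mult_less_0_iff)
    qed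
  qed
  define \<phi> where "\<phi> m t = cutoff D m t * (gp t - \<alpha> m * gn t)" for m t
  have \<phi>_split: "\<phi> m t = cutoff D m t * gp t - \<alpha> m * (cutoff D m t * gn t)" for m t
    by (simp add: \<phi>_def algebra_simps)
  have \<phi>C: "\<phi> m \<in> C_per" for m
  proof -
    have "continuous_on UNIV (\<phi> m)" unfolding \<phi>_split
      by (intro continuous_on_diff continuous_on_mult_left cutoff_mult_continuous[OF D(1) gB(1)]
          cutoff_mult_continuous[OF D(1) gB(2)] gc)
    moreover have "periodic_2pi (\<phi> m)"
      using cutoff_periodic[OF Dper, of m] per by (simp add: periodic_2pi_def \<phi>_def gp_def gn_def)
    ultimately show ?thesis by (simp add: C_per_def)
  qed
  define F where "F m u = a * mu K + (LINT t:{0..2*pi}|lebesgue. K (t - u) * \<phi> m t)" for m u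
  have F: "F m u = a * mu K + ((LINT t:{0..2*pi}|lebesgue. K (t - u) * (cutoff D m t * gp t))
      - \<alpha> m * (LINT t:{0..2*pi}|lebesgue. K (t - u) * (cutoff D m t * gn t)))" for m u
  proof -
    have "(LINT t:{0..2*pi}|lebesgue. K (t - u) * \<phi> m t) =
      (LINT t:{0..2*pi}|lebesgue. K (t - u) * (cutoff D m t * gp t) - \<alpha> m * (K (t - u) * (cutoff D m t * gn t)))"
      by (simp add: \<phi>_split right_diff_distrib mult.left_commute)
    also have "\<dots> = (LINT t:{0..2*pi}|lebesgue. K (t - u) * (cutoff D m t * gp t))
      - (LINT t:{0..2*pi}|lebesgue. \<alpha> m * (K (t - u) * (cutoff D m t * gn t)))"
      by (rule set_integral_diff(2)) (intro lim_p(1) lim_n(1) Ku set_integrable_mult_right)+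
    finally show ?thesis by (simp add: F_def)
  qed
  have "?f u = a * mu K + ((LINT t:{0..2*pi}|lebesgue. K (t - u) * gp t) - 1 * (LINT t:{0..2*pi}|lebesgue. K (t - u) * gn t))" for u
    using set_integral_diff(2)[OF lim_p(2)[OF Ku] lim_n(2)[OF Ku], of u] by (simp add: g right_diff_distrib)
  moreover have "(\<lambda>m. F m u) \<longlonglongrightarrow> a * mu K + ((LINT t:{0..2*pi}|lebesgue. K (t - u) * gp t) - 1 * (LINT t:{0..2*pi}|lebesgue. K (t - u) * gn t))" for u
    unfolding F by (intro tendsto_intros \<alpha> lim_p(3) lim_n(3) Ku)
  ultimately have lim: "(\<lambda>m. F m u) \<longlonglongrightarrow> ?f u" for u by simp
  have "\<forall>\<^sub>F m in sequentially. F m (y i) * F m (y (Suc i)) < 0" if "i \<in> {1..N}" for i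
    using alt that by (intro order_tendstoD(2)[OF tendsto_mult[OF lim lim]]) (auto simp: alternates_def)
  then have "\<forall>\<^sub>F m in sequentially. \<forall>i\<in>{1..N}. F m (y i) * F m (y (Suc i)) < 0"
    by (simp add: eventually_ball_finite)
  with bal have "\<forall>\<^sub>F m in sequentially. mu K * (P m - \<alpha> m * Q m) = 0 \<and> (\<forall>i\<in>{1..N}. F m (y i) * F m (y (Suc i)) < 0)"
    by (rule eventually_conj)
  from eventually_happens'[OF sequentially_bot this]
  obtain m where m: "mu K * (P m - \<alpha> m * Q m) = 0" "\<And>i. i\<in>{1..N} \<Longrightarrow> F m (y i) * F m (y (Suc i)) < 0"
    by blast
  have "perp (\<phi> m) (mu K)"
  proof -
    have "(LINT t:{0..2*pi}|lebesgue. \<phi> m t) = P m - (LINT t:{0..2*pi}|lebesgue. \<alpha> m * (cutoff D m t * gn t))"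
      unfolding \<phi>_split P_def using lim_p(1)[OF one, of m] lim_n(1)[OF one, of m]
      by (intro set_integral_diff(2) set_integrable_mult_right) simp_all
    then show ?thesis using m(1) by (simp add: perp_def Q_def)
  qed
  then have "sign_changes (F m) \<le> sign_changes (\<phi> m)"
    unfolding F_def by (intro CVD_kernel_correlation CVD \<phi>C)
  moreover have "enat N \<le> sign_changes (F m)"
    using alt m(2) by (intro sign_changes_ge[of _ _ y]) (simp add: alternates_def)
  moreover have "sign_changes (\<phi> m) \<le> sign_changes g"
  proof (rule sign_changes_mono)
    have pos: "g t > 0" if "\<phi> m t > 0" for t
      using that cutoff_bounds(1)[of D m t] \<alpha>(1)[of m]
      by (auto simp: \<phi>_def gp_def gn_def zero_less_mult_iff max_def split: if_splits)
    have neg: "g t < 0" if "\<phi> m t < 0" for t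
      using that cutoff_bounds(1)[of D m t] \<alpha>(1)[of m]
      by (auto simp: \<phi>_def gp_def gn_def mult_less_0_iff max_def split: if_splits)
    show "g s * g t < 0" if "\<phi> m s * \<phi> m t < 0" for s t
      using that pos neg by (auto simp: mult_less_0_iff)
  qed
  ultimately show "enat N \<le> sign_changes g" by order
qed

text \<open>This description of the arcs makes periodicity, openness and the location of the end points
  immediate.\<close>

lemma arcs_eq_cos_greater:
  assumes "0 < h" "h < pi"
  shows "arcs h x = {t. cos (t - x) > cos h}" and "countable {t. cos (t - x) = cos h}"
proof -
  have red: "\<exists>j::int. \<bar>t - x - 2*pi*j\<bar> \<le> pi" for t
  proof -
    define j where "j = \<lfloor>(t - x + pi) / (2*pi)\<rfloor>"
    have "of_int j \<le> (t - x + pi) / (2*pi)" "(t - x + pi) / (2*pi) < of_int j + 1"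
      unfolding j_def by linarith+
    then have "of_int j * (2*pi) \<le> t - x + pi" "t - x + pi < (of_int j + 1) * (2*pi)"
      by (simp_all add: pos_le_divide_eq pos_divide_less_eq)
    then have "\<bar>t - x - 2*pi*j\<bar> \<le> pi" by (auto simp: abs_le_iff algebra_simps)
    then show ?thesis ..
  qed
  have c: "cos (t - x) = cos \<bar>t - x - 2*pi*j\<bar>" for t and j :: int
    using periodic_2pi_int[of cos "t - x" "- j"] by (simp add: periodic_2pi_def)
  show "arcs h x = {t. cos (t - x) > cos h}"
  proof (intro equalityI subsetI)
    fix t assume "t \<in> arcs h x"
    then obtain j :: int where "\<bar>t - x - 2*pi*j\<bar> < h" by (auto simp: mem_arcs)
    then show "t \<in> {t. cos (t - x) > cos h}"
      using assms cos_monotone_0_pi[of "\<bar>t - x - 2*pi*j\<bar>" h] by (simp add: c[of t j])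
  next
    fix t assume t: "t \<in> {t. cos (t - x) > cos h}"
    obtain j :: int where j: "\<bar>t - x - 2*pi*j\<bar> \<le> pi" using red by blast
    then have "\<bar>t - x - 2*pi*j\<bar> < h"
      using t assms cos_monotone_0_pi_le[of h "\<bar>t - x - 2*pi*j\<bar>"] by (force simp: c[of t j])
    then show "t \<in> arcs h x" by (auto simp: mem_arcs)
  qed
  have "{t. cos (t - x) = cos h} \<subseteq> range (\<lambda>j::int. x + 2*pi*j + h) \<union> range (\<lambda>j::int. x + 2*pi*j - h)"
  proof
    fix t assume t: "t \<in> {t. cos (t - x) = cos h}"
    obtain j :: int where j: "\<bar>t - x - 2*pi*j\<bar> \<le> pi" using red by blast
    then have "\<bar>t - x - 2*pi*j\<bar> = h"
      using t assms cos_inj_pi[of "\<bar>t - x - 2*pi*j\<bar>" h] by (simp add: c[of t j])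
    then have "t = x + 2*pi*j + h \<or> t = x + 2*pi*j - h" by linarith
    then show "t \<in> range (\<lambda>j::int. x + 2*pi*j + h) \<union> range (\<lambda>j::int. x + 2*pi*j - h)" by auto
  qed
  then show "countable {t. cos (t - x) = cos h}" by (rule countable_subset) auto
qed

lemma indicator_arcs_isCont:
  assumes "0 < h" "h < pi" "cos (t - x) \<noteq> cos h"
  shows "isCont (indicat_real (arcs h x)) t"
proof -
  have o: "open {s. cos (s - x) > cos h}" "open {s. cos (s - x) < cos h}"
    by (intro open_Collect_less continuous_intros)+
  have "\<forall>\<^sub>F s in nhds t. indicat_real (arcs h x) s = indicat_real (arcs h x) t"
  proof (cases "cos (t - x) > cos h")
    case True
    then have "\<forall>\<^sub>F s in nhds t. s \<in> {s. cos (s - x) > cos h}" using o by (intro eventually_nhds_in_open) auto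
    then show ?thesis by eventually_elim (use True in \<open>simp add: arcs_eq_cos_greater[OF assms(1,2)]\<close>)
  next
    case False
    then have "\<forall>\<^sub>F s in nhds t. s \<in> {s. cos (s - x) < cos h}" using o assms by (intro eventually_nhds_in_open) auto
    then show ?thesis by eventually_elim (use False in \<open>simp add: arcs_eq_cos_greater[OF assms(1,2)]\<close>)
  qed
  then show ?thesis using isCont_cong[of _ "\<lambda>_. indicat_real (arcs h x) t" t] by simp
qed

text \<open>The possible jumps of \<open>H_fun n h c x\<close>.\<close>

definition arc_ends :: "nat \<Rightarrow> real \<Rightarrow> (nat \<Rightarrow> real) \<Rightarrow> real set" where
  "arc_ends n h x = (\<Union>k\<in>{1..n}. {t. cos (t - x k) = cos h})"

lemma arc_ends_closed: "closed (arc_ends n h x)"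
  unfolding arc_ends_def by (intro closed_UN ballI closed_Collect_eq continuous_intros) simp

lemma arc_ends_null:
  assumes "0 < h" "h < pi"
  shows "arc_ends n h x \<in> null_sets lebesgue"
proof -
  have "countable (arc_ends n h x)" unfolding arc_ends_def by (intro countable_UN arcs_eq_cos_greater(2)[OF assms]) simp
  then have "arc_ends n h x \<in> null_sets lborel" by (rule countable_imp_null_set_lborel)
  then show ?thesis by (rule null_sets_completionI)
qed

lemma arc_ends_periodic: "t + 2*pi \<in> arc_ends n h x \<longleftrightarrow> t \<in> arc_ends n h x"
proof -
  have "cos (t + 2*pi - x k) = cos (t - x k)" for k
    using cos_periodic[of "t - x k"] by (simp add: algebra_simps)
  then show ?thesis by (simp add: arc_ends_def)
qed

lemma arc_ends_nonempty: "n \<ge> 1 \<Longrightarrow> arc_ends n h x \<noteq> {}"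
  unfolding arc_ends_def by (auto intro!: bexI[of _ 1] exI[of _ "x 1 + h"])

lemma H_fun_isCont:
  assumes "0 < h" "h < pi" "t \<notin> arc_ends n h x"
  shows "isCont (H_fun n h c x) t"
  unfolding H_fun_arcs
  by (intro continuous_intros indicator_arcs_isCont) (use assms in \<open>auto simp: arc_ends_def\<close>)

lemma H_fun_measurable: "H_fun n h c x \<in> borel_measurable lebesgue"
proof -
  have "H_fun n h c x \<in> borel_measurable borel" unfolding H_fun_arcs by measurable
  then show ?thesis by (simp add: measurable_completion)
qed

lemma H_fun_bounded: "h > 0 \<Longrightarrow> \<bar>H_fun n h c x t\<bar> \<le> 1 / (2*h) * (\<Sum>k=1..n. \<bar>c k\<bar>)"
proof -
  assume h: "h > 0"
  have "\<bar>\<Sum>k=1..n. c k * indicat_real (arcs h (x k)) t\<bar> \<le> (\<Sum>k=1..n. \<bar>c k * indicat_real (arcs h (x k)) t\<bar>)"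
    by (rule sum_abs)
  also have "\<dots> \<le> (\<Sum>k=1..n. \<bar>c k\<bar>)" by (intro sum_mono) (auto simp: indicator_def)
  finally show ?thesis using h by (simp add: H_fun_arcs abs_mult divide_right_mono)
qed

section \<open>Comparison with equidistant nodes\<close>

lemma const_L1_per: "(\<lambda>_. c) \<in> L1_per"
  by (rule C_per_L1_per) (simp add: C_per_def periodic_2pi_def)

lemma H_fun_mean:
  assumes "0 < h" "h < pi"
  shows "(LINT t:{0..2*pi}|lebesgue. H_fun n h c x t) = (\<Sum>k=1..n. c k)"
    and "set_integrable lebesgue {0..2*pi} (H_fun n h c x)"
proof -
  have "(LINT t:{x k - h..x k + h}|lebesgue. (1::real)) = 2*h" for k
    using assms by (simp add: set_lebesgue_integral_def)
  then show "(LINT t:{0..2*pi}|lebesgue. H_fun n h c x t) = (\<Sum>k=1..n. c k)"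
    using H_fun_integral(1)[OF const_L1_per[of 1] assms, of n c x] assms by simp
  show "set_integrable lebesgue {0..2*pi} (H_fun n h c x)"
    using H_fun_integral(2)[OF const_L1_per[of 1] assms, of n c x] by simp
qed

lemma equi_nodes_admissible:
  assumes "n \<ge> 1" "0 < h" "h < pi / real n"
  shows "admissible_nodes n h (\<lambda>k. equi_nodes n k + s)"
proof -
  have "equi_nodes n (Suc k) = equi_nodes n k + 2*pi/n" for k
    using assms by (simp add: equi_nodes_def field_simps)
  moreover have "equi_nodes n n = 2*pi" "equi_nodes n 1 = 2*pi/n" using assms by (auto simp: equi_nodes_def)
  moreover have "2*h < 2*pi/n" using assms by simp
  ultimately show ?thesis by (simp add: admissible_nodes_def)
qed

lemma M_fun_difference:
  assumes K: "K \<in> L1_per" and h: "0 < h" "h < pi"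
  shows "M_fun K n h c z u - M_fun K n h d x u =
     (LINT t:{0..2*pi}|lebesgue. K (t - u) * (H_fun n h d x t - H_fun n h c z t))"
proof -
  have Ku: "(\<lambda>t. K (t - u)) \<in> L1_per" using L1_per_shift[OF K, of "-u"] by simp
  have "(LINT t:{0..2*pi}|lebesgue. K (t - u) * (H_fun n h d x t - H_fun n h c z t)) =
     (LINT t:{0..2*pi}|lebesgue. K (t - u) * H_fun n h d x t) - (LINT t:{0..2*pi}|lebesgue. K (t - u) * H_fun n h c z t)"
    unfolding right_diff_distrib by (intro set_integral_diff(2) H_fun_integral(2) Ku h)
  then show ?thesis
    by (simp add: H_fun_integral(1)[OF Ku h] M_fun_eq[OF K h] arc_mean_def)
qed

text \<open>The translates of \<open>v1\<close> by multiples of \<open>2*pi/n\<close> are interlaced with those of \<open>v2\<close>. The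
  function \<open>P\<close> is the periodic function whose values decide the sign of \<open>f\<close>.\<close>

lemma alternates_of_period:
  assumes n: "n \<ge> 1" and per: "\<And>u. P (u + 2*pi/real n) = P u"
    and pos: "\<And>u. P u = P v1 \<Longrightarrow> f u > 0" and neg: "\<And>u. P u = P v2 \<Longrightarrow> f u < 0"
  shows "\<exists>y. alternates f (2*n) y"
proof -
  define p where "p = 2*pi / real n"
  have p: "p > 0" using n by (simp add: p_def)
  have pi: "P (u + p * real_of_int j) = P u" for u j
    by (rule periodic_int_multiple) (use per in \<open>simp add: p_def\<close>)
  define j where "j = \<lfloor>(v1 - v2) / p\<rfloor> + 1"
  \<comment> \<open>the translate of \<open>v2\<close> that lies between \<open>v1\<close> and \<open>v1 + p\<close>\<close>
  define w where "w = v2 + p * real_of_int j"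
  have "(v1 - v2) / p < real_of_int j" "real_of_int j \<le> (v1 - v2) / p + 1" unfolding j_def by linarith+
  then have "v1 < w" "w \<le> v1 + p" using p by (auto simp: w_def field_simps)
  moreover have "w \<noteq> v1 + p"
  proof
    assume "w = v1 + p"
    then have "P v2 = P v1" using pi[of v2 j] pi[of v1 1] by (simp add: w_def)
    then show False using pos[of v1] neg[of v1] by simp
  qed
  ultimately have w: "v1 < w" "w < v1 + p" by auto
  define y where "y i = (if i = Suc (2*n) then v1 else if odd i then v1 + p * real (i div 2)
     else w + p * real (i div 2 - 1))" for i
  have f1: "f (v1 + p * real k) > 0" for k using pos pi[of v1 "int k"] by simp
  have f2: "f (w + p * real k) < 0" for k using neg pi[of w "int k"] pi[of v2 j] by (simp add: w_def)
  have yo: "y (Suc (2*k)) = v1 + p * real k" if "k < n" for k using that by (simp add: y_def)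
  have ye: "y (Suc (Suc (2*k))) = w + p * real k" if "k < n" for k using that by (simp add: y_def)
  have cases: "(\<exists>k<n. i = Suc (2*k)) \<or> (\<exists>k<n. i = Suc (Suc (2*k)))" if "i \<in> {1..2*n}" for i
  proof (cases "odd i")
    case True
    then obtain k where "i = 2*k+1" by (rule oddE)
    then show ?thesis using that by auto
  next
    case False
    then obtain k where "i = 2*k" by (auto elim: evenE)
    then show ?thesis using that by (intro disjI2 exI[of _ "k-1"]) auto
  qed
  have nxt: "y (Suc (Suc (Suc (2*k)))) = (if Suc k = n then v1 else v1 + p * real (Suc k))" if "k < n" for k
    using that yo[of "Suc k"] by (auto simp: y_def)
  have fnxt: "f (y (Suc (Suc (Suc (2*k))))) > 0" if "k < n" for k
    unfolding nxt[OF that] using f1[of "Suc k"] pos[of v1] by (simp only: split: if_split) simp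
  have "y i < y (Suc i)" if "i \<in> {1..<2*n}" for i
    using cases[of i] that w p by (auto simp: yo ye nxt distrib_left)
  moreover have "f (y i) * f (y (Suc i)) < 0" if "i \<in> {1..2*n}" for i
    using cases[OF that] f1 f2 fnxt by (auto simp: yo ye mult_less_0_iff)
  moreover have "y (2*n) < y 1 + 2*pi"
  proof -
    have "y (2*n) = w + p * real (n - 1)" using ye[of "n-1"] n
      by (metis Suc_diff_1 Suc_pred diff_less less_le_trans mult_2 add_Suc add_Suc_right zero_less_one)
    moreover have "p * real (n - 1) = 2*pi - p" using n by (simp add: p_def of_nat_diff field_simps)
    ultimately show ?thesis using yo[of 0] n w by simp
  qed
  moreover have "y (Suc (2*n)) = y 1" using yo[of 0] n by (simp add: y_def)
  ultimately show ?thesis using n by (intro exI[of _ y]) (simp add: alternates_def)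
qed

text \<open>The zero count behind the theorem: \<open>f\<close> changes sign at least \<open>2*n\<close> times since the equidistant
  part dominates at its alternation points, and at most \<open>2*n - 2\<close> times since it is the correlation
  of \<open>K\<close> with the difference \<open>g\<close> of two aligned step functions. The hypothesis \<open>bal\<close> says that \<open>g\<close>
  has mean zero when \<open>mu K = 1\<close>.\<close>

lemma no_uniformly_smaller_M_fun:
  assumes CVD: "CVD_kernel K" and n: "n \<ge> 1" and h: "0 < h" "h < pi / real n"
    and x: "admissible_nodes n h x" and lam: "lam > 0"
    and bal: "mu K * ((\<Sum>k=1..n. c k) - real n * lam) = 0"
    and small: "\<And>u. \<bar>M_fun K n h c x u - l * mu K\<bar> \<le> m"
    and u1: "equi_M K n h lam u1 - l' * mu K > m" and u2: "equi_M K n h lam u2 - l' * mu K < - m"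
  shows False
proof -
  have K: "K \<in> L1_per" using CVD by (simp add: CVD_kernel_def)
  have "pi / real n \<le> pi" using n by (simp add: divide_le_eq)
  then have hpi: "h < pi" using h by linarith
  \<comment> \<open>translation that puts the first equidistant node on the first node of the given functional\<close>
  define s where "s = x 1 - equi_nodes n 1"
  define z where "z k = equi_nodes n k + s" for k
  have z: "admissible_nodes n h z" unfolding z_def by (rule equi_nodes_admissible[OF n h])
  define g where "g t = H_fun n h c x t - H_fun n h (\<lambda>_. lam) z t" for t
  have sg: "sign_changes g \<le> enat (2 * (n - 1))"
    unfolding g_def by (rule sign_changes_bump_difference_le[OF x z h(1) n _ lam]) (simp add: z_def s_def)
  define f where "f u = (l - l') * mu K + (LINT t:{0..2*pi}|lebesgue. K (t - u) * g t)" for u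
  have Mz: "M_fun K n h (\<lambda>_. lam) z u = equi_M K n h lam (u - s)" for u
    unfolding z_def by (rule M_fun_shift[OF K h(1) hpi])
  have f: "f u = (equi_M K n h lam (u - s) - l' * mu K) - (M_fun K n h c x u - l * mu K)" for u
    unfolding f_def g_def M_fun_difference[OF K h(1) hpi, symmetric] Mz by (simp add: algebra_simps)
  have "sign_changes f \<le> sign_changes g"
    unfolding f_def
  proof (rule CVD_kernel_piecewise_continuous[OF CVD])
    let ?D = "arc_ends n h x \<union> arc_ends n h z"
    show "periodic_2pi g" using H_fun_periodic[of n h] by (simp add: g_def periodic_2pi_def)
    show "g \<in> borel_measurable lebesgue" unfolding g_def by (intro borel_measurable_diff H_fun_measurable)
    show "\<bar>g t\<bar> \<le> 1 / (2*h) * (\<Sum>k=1..n. \<bar>c k\<bar>) + 1 / (2*h) * (\<Sum>k=1..n. \<bar>lam\<bar>)" for t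
      using H_fun_bounded[OF h(1), of n c x t] H_fun_bounded[OF h(1), of n "\<lambda>_. lam" z t]
      unfolding g_def by linarith
    show "closed ?D" by (intro closed_Un arc_ends_closed)
    show "?D \<noteq> {}" using arc_ends_nonempty[OF n] by blast
    show "?D \<in> null_sets lebesgue" by (intro null_sets.Un arc_ends_null h hpi)
    show "t + 2*pi \<in> ?D \<longleftrightarrow> t \<in> ?D" for t by (simp add: arc_ends_periodic)
    show "isCont g t" if "t \<notin> ?D" for t
      unfolding g_def by (intro continuous_intros H_fun_isCont h hpi) (use that in auto)
    have "(LINT t:{0..2*pi}|lebesgue. g t) = (\<Sum>k=1..n. c k) - real n * lam"
      unfolding g_def using set_integral_diff(2)[OF H_fun_mean(2) H_fun_mean(2)] H_fun_mean(1) h hpi by simp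
    then show "perp g (mu K)" using bal by (simp add: perp_def)
  qed
  also note sg
  finally have "sign_changes f \<le> enat (2 * (n - 1))" .
  moreover have "\<exists>y. alternates f (2*n) y"
  proof (rule alternates_of_period[OF n, of "\<lambda>u. equi_M K n h lam (u - s)" "u1 + s" f "u2 + s"])
    show "equi_M K n h lam (u + 2*pi / real n - s) = equi_M K n h lam (u - s)" for u
      using equi_M_period[OF K h(1) hpi n, of lam "u - s"] by (simp add: algebra_simps)
    show "f u > 0" if "equi_M K n h lam (u - s) = equi_M K n h lam (u1 + s - s)" for u
      using that u1 small[of u] unfolding f by (simp add: abs_le_iff)
    show "f u < 0" if "equi_M K n h lam (u - s) = equi_M K n h lam (u2 + s - s)" for u
      using that u2 small[of u] unfolding f by (simp add: abs_le_iff)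
  qed
  then have "enat (2*n) \<le> sign_changes f" using sign_changes_ge by blast
  ultimately have "enat (2*n) \<le> enat (2 * (n - 1))" by order
  then show False using n by simp
qed

section \<open>The error on the class as a norm of M\<close>

lemma C_per_attains_sup:
  assumes "F \<in> C_per"
  shows "\<exists>u. \<forall>v. F v \<le> F u"
proof -
  have per: "periodic_2pi F" and cont: "continuous_on {0..2*pi} F"
    using assms by (auto simp: C_per_def intro: continuous_on_subset)
  have "\<exists>u\<in>{0..2*pi}. \<forall>v\<in>{0..2*pi}. F v \<le> F u"
    by (intro continuous_attains_sup cont) auto
  then obtain u where u: "\<forall>v\<in>{0..2*pi}. F v \<le> F u" by blast
  have "F v \<le> F u" for v using periodic_2pi_value_in_period[OF per, of v] u by metis
  then show ?thesis by blast
qed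

lemma C_per_within_iff_oscillation:
  assumes F: "F \<in> C_per"
  shows "(\<exists>l. \<forall>u. \<bar>F u - l\<bar> \<le> m) \<longleftrightarrow> (\<forall>u v. F u - F v \<le> 2*m)"
proof
  assume "\<exists>l. \<forall>u. \<bar>F u - l\<bar> \<le> m"
  then obtain l where "\<And>u. \<bar>F u - l\<bar> \<le> m" by blast
  then have "\<And>u. F u - l \<le> m \<and> l - F u \<le> m" by (auto simp: abs_le_iff)
  then show "\<forall>u v. F u - F v \<le> 2*m" by (smt (verit))
next
  assume *: "\<forall>u v. F u - F v \<le> 2*m"
  obtain a where a: "\<And>v. F v \<le> F a" using C_per_attains_sup[OF F] by blast
  have "\<bar>F u - (F a - m)\<bar> \<le> m" for u using a[of u] *[rule_format, of a u] by linarith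
  then show "\<exists>l. \<forall>u. \<bar>F u - l\<bar> \<le> m" by blast
qed

text \<open>For continuous functions the essential supremum is the supremum, because a closed condition
  that holds almost everywhere on an open interval holds everywhere on it.\<close>

lemma Linf_norm_le_iff:
  assumes F: "F \<in> C_per"
  shows "Linf_norm F \<le> ereal m \<longleftrightarrow> (\<forall>u. \<bar>F u\<bar> \<le> m)"
proof -
  let ?M = "restrict_space lebesgue {0..2*pi::real}"
  have cont: "continuous_on UNIV F" and per: "periodic_2pi F" using F by (auto simp: C_per_def)
  have "(\<lambda>t. ereal \<bar>F t\<bar>) \<in> borel_measurable borel"
    using borel_measurable_continuous_onI[OF cont] by measurable
  then have "(\<lambda>t. ereal \<bar>F t\<bar>) \<in> borel_measurable lebesgue" by (simp add: measurable_completion)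
  then have meas: "(\<lambda>t. ereal \<bar>F t\<bar>) \<in> borel_measurable ?M" by (rule measurable_restrict_space1)
  show ?thesis
  proof
    assume "\<forall>u. \<bar>F u\<bar> \<le> m"
    then show "Linf_norm F \<le> ereal m"
      unfolding Linf_norm_def by (intro esssup_I meas AE_I2) simp
  next
    assume le: "Linf_norm F \<le> ereal m"
    have "AE t in ?M. ereal \<bar>F t\<bar> \<le> Linf_norm F" unfolding Linf_norm_def by (rule esssup_AE)
    then have "AE t in ?M. \<bar>F t\<bar> \<le> m"
      by eventually_elim (use le in \<open>metis ereal_less_eq(3) order_trans\<close>)
    then have ae: "AE t in lebesgue. t \<in> {0..2*pi} \<longrightarrow> \<bar>F t\<bar> \<le> m"
      by (subst (asm) AE_restrict_space_iff) auto
    have cl: "closed {t. \<bar>F t\<bar> \<le> m}" by (intro closed_Collect_le continuous_intros cont)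
    have inner: "\<bar>F t\<bar> \<le> m" if "t \<in> {0<..<2*pi}" for t
    proof -
      have "AE t in lebesgue. t \<in> {0<..<2*pi} \<longrightarrow> t \<in> {t. \<bar>F t\<bar> \<le> m}" using ae by eventually_elim auto
      then show ?thesis using mem_closed_if_AE_lebesgue_open[OF _ cl _ that] by simp
    qed
    have "closure {0<..<2*pi} \<subseteq> {t. \<bar>F t\<bar> \<le> m}" using inner cl by (intro closure_minimal) auto
    then have "\<bar>F t\<bar> \<le> m" if "t \<in> {0..2*pi}" for t using that by auto
    then show "\<forall>u. \<bar>F u\<bar> \<le> m" using periodic_2pi_value_in_period[OF per] by metis
  qed
qed

lemma small_mean_near:
  assumes F: "continuous_on UNIV F" and d: "d > 0"
  shows "\<exists>r. 0 < r \<and> r < pi \<and> \<bar>1 / (2*r) * (LINT t:{u - r..u + r}|lebesgue. F t) - F u\<bar> \<le> d"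
proof -
  have "isCont F u" using F by (simp add: continuous_on_eq_continuous_at)
  then obtain e where e: "e > 0" "\<And>t. \<bar>t - u\<bar> < e \<Longrightarrow> \<bar>F t - F u\<bar> < d"
    using d unfolding continuous_at_eps_delta dist_real_def by blast
  define r where "r = min (e/2) 1"
  have r: "0 < r" "r < e" "r < pi" using e pi_gt3 by (auto simp: r_def)
  have i: "set_integrable lebesgue {u - r..u + r} F"
    by (intro absolutely_integrable_continuous_real continuous_on_subset[OF F]) simp
  have c: "set_integrable lebesgue {u - r..u + r} (\<lambda>_. C)" for C :: real
    by (intro absolutely_integrable_on_const) simp
  have ci: "(LINT t:{u - r..u + r}|lebesgue. C) = 2*r*C" for C :: real
    using r by (simp add: set_lebesgue_integral_def)
  have b: "F t \<le> F u + d" "F u - d \<le> F t" if "t \<in> {u - r..u + r}" for t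
    using e(2)[of t] that r by (auto simp: abs_less_iff)
  have "(LINT t:{u - r..u + r}|lebesgue. F t) \<le> 2*r*(F u + d)"
    unfolding ci[symmetric] by (intro set_integral_mono i c b)
  moreover have "2*r*(F u - d) \<le> (LINT t:{u - r..u + r}|lebesgue. F t)"
    unfolding ci[symmetric] by (intro set_integral_mono i c b)
  ultimately have "\<bar>1 / (2*r) * (LINT t:{u - r..u + r}|lebesgue. F t) - F u\<bar> \<le> d"
    using r(1) by (simp add: abs_le_iff field_simps)
  then show ?thesis using r by blast
qed

text \<open>A normalized indicator of a short arc, which is the function \<^const>\<open>H_fun\<close> of a single node,
  approximates evaluation at \<open>u\<close> by an element of the unit ball.\<close>

lemma point_evaluation_approximation:
  assumes F: "F \<in> C_per" and d: "d > 0"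
  shows "\<exists>\<delta>\<in>L1_per. (\<forall>t. \<delta> t \<ge> 0) \<and> (LINT t:{0..2*pi}|lebesgue. \<delta> t) = 1 \<and>
    \<bar>(LINT t:{0..2*pi}|lebesgue. \<delta> t * F t) - F u\<bar> \<le> d"
proof -
  obtain r where r: "0 < r" "r < pi" and near: "\<bar>1 / (2*r) * (LINT t:{u - r..u + r}|lebesgue. F t) - F u\<bar> \<le> d"
    using small_mean_near[OF _ d, of F u] F by (auto simp: C_per_def)
  define \<delta> where "\<delta> = H_fun 1 r (\<lambda>_. 1) (\<lambda>_. u)"
  have "\<delta> \<in> L1_per" using H_fun_mean(2)[OF r] H_fun_periodic by (simp add: \<delta>_def L1_per_def)
  moreover have "\<delta> t \<ge> 0" for t unfolding \<delta>_def by (rule H_fun_nonneg) (use r in auto)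
  moreover have "(LINT t:{0..2*pi}|lebesgue. \<delta> t) = 1" using H_fun_mean(1)[OF r] by (simp add: \<delta>_def)
  moreover have "(LINT t:{0..2*pi}|lebesgue. \<delta> t * F t) = 1 / (2*r) * (LINT t:{u - r..u + r}|lebesgue. F t)"
    using H_fun_integral(1)[OF C_per_L1_per[OF F] r, of 1 "\<lambda>_. 1" "\<lambda>_. u"] by (simp add: \<delta>_def mult.commute)
  ultimately show ?thesis using near by (intro bexI[of _ \<delta>]) auto
qed

lemma integral_mult_le_L1_norm:
  assumes \<phi>: "\<phi> \<in> L1_per" and F: "F \<in> C_per" and m: "\<And>u. \<bar>F u\<bar> \<le> m"
  shows "\<bar>LINT t:{0..2*pi}|lebesgue. \<phi> t * F t\<bar> \<le> m * L1_norm \<phi>"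
proof -
  have i: "set_integrable lebesgue {0..2*pi} (\<lambda>t. \<phi> t * F t)"
    using L1_per_integrable[OF L1_per_mult_C_per[OF \<phi> F]] .
  have i2: "set_integrable lebesgue {0..2*pi} (\<lambda>t. m * \<bar>\<phi> t\<bar>)"
    by (intro set_integrable_mult_right set_integrable_abs L1_per_integrable[OF \<phi>])
  have "\<bar>LINT t:{0..2*pi}|lebesgue. \<phi> t * F t\<bar> \<le> (LINT t:{0..2*pi}|lebesgue. \<bar>\<phi> t * F t\<bar>)"
    using integral_norm_bound[of lebesgue "\<lambda>t. indicat_real {0..2*pi} t *\<^sub>R (\<phi> t * F t)"]
    by (simp add: set_lebesgue_integral_def abs_mult)
  also have "\<dots> \<le> (LINT t:{0..2*pi}|lebesgue. m * \<bar>\<phi> t\<bar>)"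
  proof (rule set_integral_mono[OF set_integrable_abs[OF i] i2])
    show "\<bar>\<phi> t * F t\<bar> \<le> m * \<bar>\<phi> t\<bar>" for t
      using mult_right_mono[OF m[of t], of "\<bar>\<phi> t\<bar>"] by (simp add: abs_mult mult.commute)
  qed
  finally show ?thesis by (simp add: L1_norm_def)
qed

lemma class_error_le_iff:
  "class_error K q \<le> ereal m \<longleftrightarrow>
    (\<forall>a \<phi>. \<phi> \<in> F1 \<longrightarrow> perp \<phi> (mu K) \<longrightarrow> \<bar>quad_rem (\<lambda>x. a * mu K + conv_per K \<phi> x) q\<bar> \<le> m)"
  unfolding class_error_def conv_class_def by (auto simp: SUP_le_iff)

lemma M_fun_C_per:
  assumes "K \<in> L1_per" "0 < h" "h < pi"
  shows "M_fun K n h c x \<in> C_per"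
  using M_fun_continuous[OF assms] M_fun_periodic[OF assms] by (simp add: C_per_def)

lemma L1_norm_nonneg_fun: "(\<And>t. \<phi> t \<ge> 0) \<Longrightarrow> L1_norm \<phi> = (LINT t:{0..2*pi}|lebesgue. \<phi> t)"
  by (simp add: L1_norm_def)

text \<open>Duality of \<open>L1\<close> and the supremum norm; approximate point evaluations show that the bound is
  attained in the limit.\<close>

lemma class_error_eq_Linf_norm:
  assumes K: "K \<in> L1_per" and h: "0 < h" "h < pi" and mu: "mu K = 0"
  shows "class_error K (quad n h c x) = Linf_norm (M_fun K n h c x)"
proof -
  let ?M = "M_fun K n h c x"
  have M: "?M \<in> C_per" by (rule M_fun_C_per[OF K h])
  have rem: "quad_rem (conv_per K \<phi>) (quad n h c x) = (LINT u:{0..2*pi}|lebesgue. \<phi> u * ?M u)"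
    if "\<phi> \<in> L1_per" for \<phi>
    using quad_rem_conv[OF K that h, of 0] by simp
  have "class_error K (quad n h c x) \<le> ereal m \<longleftrightarrow> (\<forall>u. \<bar>?M u\<bar> \<le> m)" for m
  proof
    assume le: "class_error K (quad n h c x) \<le> ereal m"
    show "\<forall>u. \<bar>?M u\<bar> \<le> m"
    proof (intro allI, rule field_le_epsilon)
      fix u and d :: real assume d: "d > 0"
      obtain \<delta> where \<delta>: "\<delta> \<in> L1_per" "\<And>t. \<delta> t \<ge> 0"
        "(LINT t:{0..2*pi}|lebesgue. \<delta> t) = 1" "\<bar>(LINT t:{0..2*pi}|lebesgue. \<delta> t * ?M t) - ?M u\<bar> \<le> d"
        using point_evaluation_approximation[OF M d, of u] by blast
      then have "\<delta> \<in> F1" by (simp add: F1_def L1_norm_nonneg_fun)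
      moreover have "perp \<delta> (mu K)" using mu by (simp add: perp_def)
      ultimately have "\<bar>LINT t:{0..2*pi}|lebesgue. \<delta> t * ?M t\<bar> \<le> m"
        using le[unfolded class_error_le_iff, rule_format, of \<delta> 0] rem[OF \<delta>(1)] by (simp add: mu)
      then show "\<bar>?M u\<bar> \<le> m + d" using \<delta>(4) by linarith
    qed
  next
    assume m: "\<forall>u. \<bar>?M u\<bar> \<le> m"
    have "m \<ge> 0" using m[rule_format, of 0] by linarith
    show "class_error K (quad n h c x) \<le> ereal m"
      unfolding class_error_le_iff
    proof (intro allI impI)
      fix a \<phi> assume "\<phi> \<in> F1" "perp \<phi> (mu K)"
      then have \<phi>: "\<phi> \<in> L1_per" "L1_norm \<phi> \<le> 1" by (auto simp: F1_def)
      then show "\<bar>quad_rem (\<lambda>x. a * mu K + conv_per K \<phi> x) (quad n h c x)\<bar> \<le> m"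
        using integral_mult_le_L1_norm[OF \<phi>(1) M, of m] m mult_left_mono[OF \<phi>(2) \<open>m \<ge> 0\<close>] by (simp add: mu rem)
    qed
  qed
  then show ?thesis
    using Linf_norm_le_iff[OF M] by (metis antisym ereal_le_real)
qed

text \<open>The constants in the class force the coefficients to sum to \<open>2*pi\<close>. On functions \<open>\<phi>\<close> of mean
  zero a constant may be subtracted from \<open>M\<close> at no cost, which gives one direction. For the other
  one, half the difference of approximate point evaluations at \<open>u\<close> and \<open>v\<close> has mean zero and norm
  at most \<open>1\<close>, and it tests the oscillation of \<open>M\<close>.\<close>

lemma class_error_le_iff_near_constant:
  assumes K: "K \<in> L1_per" and h: "0 < h" "h < pi" and mu: "mu K = 1"
  shows "class_error K (quad n h c x) \<le> ereal m \<longleftrightarrow>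
     (\<Sum>k=1..n. c k) = 2*pi \<and> (\<exists>l. \<forall>u. \<bar>M_fun K n h c x u - l\<bar> \<le> m)"
    (is "?E \<longleftrightarrow> _ \<and> ?L")
proof -
  let ?M = "M_fun K n h c x"
  have M: "?M \<in> C_per" by (rule M_fun_C_per[OF K h])
  note rem = quad_rem_conv[OF K _ h, of _ _ n c x]
  show ?thesis
  proof (intro iffI conjI)
    assume le: ?E
    show "(\<Sum>k=1..n. c k) = 2*pi"
    proof (rule ccontr)
      assume "(\<Sum>k=1..n. c k) \<noteq> 2*pi"
      \<comment> \<open>a constant function on which the remainder is \<open>\<bar>m\<bar> + 1\<close>\<close>
      define a where "a = (\<bar>m\<bar> + 1) / (2*pi - (\<Sum>k=1..n. c k))"
      have "(\<lambda>_. 0) \<in> F1" "perp (\<lambda>_. 0) (mu K)" using const_L1_per[of 0] by (auto simp: F1_def L1_norm_def perp_def)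
      then have "\<bar>a * (2*pi - (\<Sum>k=1..n. c k))\<bar> \<le> m"
        using le[unfolded class_error_le_iff, rule_format, of "\<lambda>_. 0" a] rem[OF const_L1_per[of 0], of a]
        by (simp add: mu)
      then show False using \<open>_ \<noteq> 2*pi\<close> by (simp add: a_def)
    qed
    then have rem0: "quad_rem (\<lambda>x. a + conv_per K \<phi> x) (quad n h c x) = (LINT u:{0..2*pi}|lebesgue. \<phi> u * ?M u)"
      if "\<phi> \<in> L1_per" for \<phi> a using rem[OF that, of a] by simp
    show ?L unfolding C_per_within_iff_oscillation[OF M]
    proof (intro allI, rule field_le_epsilon)
      fix u v and d :: real assume "d > 0"
      then have d: "d/2 > 0" by simp
      obtain \<delta> where \<delta>: "\<delta> \<in> L1_per" "\<And>t. \<delta> t \<ge> 0"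
        "(LINT t:{0..2*pi}|lebesgue. \<delta> t) = 1" "\<bar>(LINT t:{0..2*pi}|lebesgue. \<delta> t * ?M t) - ?M u\<bar> \<le> d/2"
        using point_evaluation_approximation[OF M d, of u] by blast
      obtain \<eta> where \<eta>: "\<eta> \<in> L1_per" "\<And>t. \<eta> t \<ge> 0"
        "(LINT t:{0..2*pi}|lebesgue. \<eta> t) = 1" "\<bar>(LINT t:{0..2*pi}|lebesgue. \<eta> t * ?M t) - ?M v\<bar> \<le> d/2"
        using point_evaluation_approximation[OF M d, of v] by blast
      define \<phi> where "\<phi> t = 1/2 * \<delta> t - 1/2 * \<eta> t" for t
      note i = L1_per_integrable[OF \<delta>(1)] L1_per_integrable[OF \<eta>(1)]
      have iM: "set_integrable lebesgue {0..2*pi} (\<lambda>t. 1/2 * (\<delta> t * ?M t))" "set_integrable lebesgue {0..2*pi} (\<lambda>t. 1/2 * (\<eta> t * ?M t))"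
        by (intro set_integrable_mult_right L1_per_integrable[OF L1_per_mult_C_per] \<delta> \<eta> M)+
      have h2: "set_integrable lebesgue {0..2*pi} (\<lambda>t. 1/2 * \<delta> t)" "set_integrable lebesgue {0..2*pi} (\<lambda>t. 1/2 * \<eta> t)"
        using i by auto
      have \<phi>i: "set_integrable lebesgue {0..2*pi} \<phi>" unfolding \<phi>_def using h2 by (rule set_integral_diff(1))
      then have \<phi>L: "\<phi> \<in> L1_per"
        using \<delta>(1) \<eta>(1) by (simp add: L1_per_def periodic_2pi_def \<phi>_def)
      have \<phi>0: "(LINT t:{0..2*pi}|lebesgue. \<phi> t) = 0"
        unfolding \<phi>_def using set_integral_diff(2)[OF h2] \<delta>(3) \<eta>(3) by simp
      have "L1_norm \<phi> \<le> (LINT t:{0..2*pi}|lebesgue. 1/2 * \<delta> t + 1/2 * \<eta> t)"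
        unfolding L1_norm_def
      proof (rule set_integral_mono[OF set_integrable_abs[OF \<phi>i] set_integral_add(1)[OF h2]])
        show "\<bar>\<phi> t\<bar> \<le> 1/2 * \<delta> t + 1/2 * \<eta> t" for t
          using \<delta>(2)[of t] \<eta>(2)[of t] unfolding \<phi>_def by linarith
      qed
      also have "\<dots> = 1" using set_integral_add(2)[OF h2] \<delta>(3) \<eta>(3) by simp
      finally have "\<phi> \<in> F1" using \<phi>L by (simp add: F1_def)
      moreover have "perp \<phi> (mu K)" using \<phi>0 by (simp add: perp_def mu)
      ultimately have "\<bar>LINT t:{0..2*pi}|lebesgue. \<phi> t * ?M t\<bar> \<le> m"
        using le[unfolded class_error_le_iff, rule_format, of \<phi> 0] rem0[OF \<phi>L, of 0] by (simp add: mu)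
      moreover have "(LINT t:{0..2*pi}|lebesgue. \<phi> t * ?M t) =
          1/2 * (LINT t:{0..2*pi}|lebesgue. \<delta> t * ?M t) - 1/2 * (LINT t:{0..2*pi}|lebesgue. \<eta> t * ?M t)"
        using set_integral_diff(2)[OF iM] by (simp add: \<phi>_def left_diff_distrib mult.assoc)
      ultimately show "?M u - ?M v \<le> 2*m + d" using \<delta>(4) \<eta>(4) by linarith
    qed
  next
    assume *: "(\<Sum>k=1..n. c k) = 2*pi \<and> ?L"
    then obtain l where l: "\<And>u. \<bar>?M u - l\<bar> \<le> m" by blast
    have "m \<ge> 0" using l[of 0] by linarith
    have Ml: "(\<lambda>u. ?M u - l) \<in> C_per"
      using M by (auto simp: C_per_def periodic_2pi_def intro: continuous_intros)
    show ?E unfolding class_error_le_iff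
    proof (intro allI impI)
      fix a \<phi> assume "\<phi> \<in> F1" "perp \<phi> (mu K)"
      then have \<phi>: "\<phi> \<in> L1_per" "L1_norm \<phi> \<le> 1" "(LINT t:{0..2*pi}|lebesgue. \<phi> t) = 0"
        by (auto simp: F1_def perp_def mu)
      have i: "set_integrable lebesgue {0..2*pi} (\<lambda>t. \<phi> t * ?M t)"
        by (rule L1_per_integrable[OF L1_per_mult_C_per[OF \<phi>(1) M]])
      have i2: "set_integrable lebesgue {0..2*pi} (\<lambda>t. l * \<phi> t)"
        by (intro set_integrable_mult_right L1_per_integrable[OF \<phi>(1)])
      have "(LINT t:{0..2*pi}|lebesgue. \<phi> t * (?M t - l)) = (LINT t:{0..2*pi}|lebesgue. \<phi> t * ?M t)"
        using set_integral_diff(2)[OF i i2] \<phi>(3) by (simp add: right_diff_distrib mult.commute)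
      then have "\<bar>LINT t:{0..2*pi}|lebesgue. \<phi> t * ?M t\<bar> \<le> m"
        using integral_mult_le_L1_norm[OF \<phi>(1) Ml l] mult_left_mono[OF \<phi>(2) \<open>m \<ge> 0\<close>] by simp
      then show "\<bar>quad_rem (\<lambda>x. a * mu K + conv_per K \<phi> x) (quad n h c x)\<bar> \<le> m"
        using rem[OF \<phi>(1), of a] * by (simp add: mu)
    qed
  qed
qed

section \<open>Optimality of equidistant nodes with equal coefficients\<close>

lemma equi_quad_in_Q_set:
  assumes "n \<ge> 1" "0 < h" "h < pi / real n"
  shows "equi_quad n h lam \<in> Q_set n h"
  using equi_nodes_admissible[OF assms, of 0] by (auto simp: Q_set_def)

text \<open>If \<open>M\<close> of the equidistant functional oscillated by more than \<open>2*m\<close>, then after subtraction of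
  the midpoint of two of its values it would exceed \<open>m\<close> in both directions.\<close>

lemma equi_quad_optimal_mu_1:
  assumes CVD: "CVD_kernel K" and n: "n \<ge> 1" and h: "0 < h" "h < pi / real n" and mu: "mu K = 1"
    and q: "q \<in> Q_set n h"
  shows "class_error K (equi_quad n h (2*pi / real n)) \<le> class_error K q"
proof (rule ereal_le_real)
  fix m assume le: "class_error K q \<le> ereal m"
  have K: "K \<in> L1_per" using CVD by (simp add: CVD_kernel_def)
  have "pi / real n \<le> pi" using n by (simp add: divide_le_eq)
  then have hpi: "h < pi" using h by linarith
  obtain c x where q: "q = quad n h c x" and x: "admissible_nodes n h x" using q by (auto simp: Q_set_def)
  obtain l where sum: "(\<Sum>k=1..n. c k) = 2*pi" and l: "\<And>u. \<bar>M_fun K n h c x u - l\<bar> \<le> m"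
    using le unfolding q class_error_le_iff_near_constant[OF K h(1) hpi mu] by blast
  let ?P = "equi_M K n h (2*pi / real n)"
  have P: "?P \<in> C_per" by (rule M_fun_C_per[OF K h(1) hpi])
  have "?P u - ?P v \<le> 2*m" for u v
  proof (rule ccontr)
    assume "\<not> ?P u - ?P v \<le> 2*m"
    then have "?P u - (?P u + ?P v)/2 > m" "?P v - (?P u + ?P v)/2 < - m" by (simp_all add: field_simps)
    moreover have "2*pi / real n > 0" "(\<Sum>k=1..n. c k) - real n * (2*pi / real n) = 0" using n sum by simp_all
    ultimately show False
      using no_uniformly_smaller_M_fun[OF CVD n h x, of "2*pi / real n" c l m u "(?P u + ?P v)/2" v] l
      unfolding mu by simp
  qed
  then have "\<exists>l. \<forall>u. \<bar>?P u - l\<bar> \<le> m" using C_per_within_iff_oscillation[OF P] by blast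
  moreover have "(\<Sum>k=1..n. 2*pi / real n) = 2*pi" using n by simp
  ultimately show "class_error K (equi_quad n h (2*pi / real n)) \<le> ereal m"
    unfolding class_error_le_iff_near_constant[OF K h(1) hpi mu] by blast
qed

lemma equi_M_affine:
  assumes K: "K \<in> L1_per" and h: "0 < h" "h < pi"
  shows "equi_M K n h lam u = (LINT t:{0..2*pi}|lebesgue. K t)
     - lam * ((LINT t:{0..2*pi}|lebesgue. K t) - equi_M K n h 1 u)"
  by (simp add: M_fun_eq[OF assms] sum_distrib_left)

text \<open>Obtained from the formula for the remainder, applied to \<open>\<phi> = 1\<close>.\<close>

lemma equi_M_integral:
  assumes K: "K \<in> L1_per" and h: "0 < h" "h < pi"
  shows "(LINT u:{0..2*pi}|lebesgue. equi_M K n h 1 u) = (LINT t:{0..2*pi}|lebesgue. K t) * (2*pi - real n)"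
proof -
  let ?\<kappa> = "LINT t:{0..2*pi}|lebesgue. K t"
  have "conv_per K (\<lambda>_. 1) x = ?\<kappa>" for x
    using L1_per_integral[OF K, of "x - 2*pi"] set_integral_flip(1)[of 0 "2*pi" K x]
    by (simp add: conv_per_def)
  then have "quad_rem (\<lambda>x. ?\<kappa>) (equi_quad n h 1) = (LINT u:{0..2*pi}|lebesgue. equi_M K n h 1 u)"
    using quad_rem_conv[OF K const_L1_per[of 1] h, of 0 n "\<lambda>_. 1" "equi_nodes n"] by simp
  moreover have "quad_rem (\<lambda>x. ?\<kappa>) (equi_quad n h 1) = ?\<kappa> * (2*pi - real n)"
  proof -
    have c: "(LINT t:{a..b}|lebesgue. ?\<kappa>) = (b - a) * ?\<kappa>" if "a \<le> b" for a b
      using that by (simp add: set_lebesgue_integral_def)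
    have "1 * (1 / (2*h)) * (LINT t:{x - h..x + h}|lebesgue. ?\<kappa>) = ?\<kappa>" for x
      using c[of "x - h" "x + h"] h by simp
    then show ?thesis
      unfolding quad_rem_def quad_def using c[of 0 "2*pi"] by (simp add: left_diff_distrib mult.commute)
  qed
  ultimately show ?thesis by simp
qed

text \<open>Suppose the error of \<open>q\<close> is less than \<open>m'\<close> while for every \<open>lam\<close> the function \<open>M\<close> of the
  equidistant functional exceeds \<open>m'\<close> in absolute value somewhere. That function is
  \<open>\<kappa> * (1 - lam * B)\<close> with \<open>\<kappa> = \<integral> K\<close> and \<open>B\<close> independent of \<open>lam\<close>; the mean of \<open>B\<close> is positive.
  Choose \<open>lam > 0\<close> such that the minimum of \<open>1 - lam * B\<close> is exactly \<open>- m' / \<bar>\<kappa>\<bar>\<close>. The bound \<open>m'\<close>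
  can then only be exceeded on the other side, so \<open>M\<close> leaves the smaller band \<open>{-m..m}\<close> in both
  directions.\<close>

lemma equi_quad_optimal_mu_0:
  assumes CVD: "CVD_kernel K" and n: "n \<ge> 1" and h: "0 < h" "h < pi / real n" and mu: "mu K = 0"
    and q: "q \<in> Q_set n h"
  shows "(INF lam::real. class_error K (equi_quad n h lam)) \<le> class_error K q"
proof (rule ccontr)
  assume "\<not> ?thesis"
  then have "class_error K q < (INF lam::real. class_error K (equi_quad n h lam))" by simp
  then obtain m' where lt: "class_error K q < ereal m'" and m': "ereal m' < (INF lam::real. class_error K (equi_quad n h lam))"
    using ereal_dense2 by blast
  have K: "K \<in> L1_per" using CVD by (simp add: CVD_kernel_def)
  have "pi / real n \<le> pi" using n by (simp add: divide_le_eq)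
  then have hpi: "h < pi" using h by linarith
  obtain c x where q: "q = quad n h c x" and x: "admissible_nodes n h x" using q by (auto simp: Q_set_def)
  have MC: "M_fun K n h c x \<in> C_per" for c x by (rule M_fun_C_per[OF K h(1) hpi])
  obtain m where m: "class_error K q < ereal m" "m < m'" using lt ereal_dense2[OF lt] by auto
  have "Linf_norm (M_fun K n h c x) \<le> ereal m" using m(1) class_error_eq_Linf_norm[OF K h(1) hpi mu] by (simp add: q)
  then have small: "\<bar>M_fun K n h c x u\<bar> \<le> m" for u using Linf_norm_le_iff[OF MC] by blast
  have "m \<ge> 0" using small[of 0] by linarith
  have large: "\<exists>u. \<bar>equi_M K n h lam u\<bar> > m'" for lam
  proof (rule ccontr)
    assume "\<not> ?thesis"
    then have "Linf_norm (equi_M K n h lam) \<le> ereal m'" unfolding Linf_norm_le_iff[OF MC] by (meson not_le)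
    moreover have "(INF lam::real. class_error K (equi_quad n h lam)) \<le> class_error K (equi_quad n h lam)"
      by (rule INF_lower) simp
    ultimately show False using m' class_error_eq_Linf_norm[OF K h(1) hpi mu] by (metis leD order_trans)
  qed
  define \<kappa> where "\<kappa> = (LINT t:{0..2*pi}|lebesgue. K t)"
  have \<kappa>: "\<kappa> \<noteq> 0" using mu by (auto simp: mu_def \<kappa>_def split: if_splits)
  define B where "B u = 1 - equi_M K n h 1 u / \<kappa>" for u
  have M: "equi_M K n h lam u = \<kappa> * (1 - lam * B u)" for lam u
  proof -
    have "\<kappa> - equi_M K n h 1 u = \<kappa> * B u" using \<kappa> by (simp add: B_def right_diff_distrib)
    then show ?thesis
      unfolding equi_M_affine[OF K h(1) hpi, of n lam u, folded \<kappa>_def]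
      by (simp add: right_diff_distrib)
  qed
  have "B \<in> C_per" using MC[of "\<lambda>_. 1" "equi_nodes n"] \<kappa> unfolding B_def
    by (auto simp: C_per_def periodic_2pi_def intro!: continuous_intros)
  then obtain v where v: "\<And>u. B u \<le> B v" using C_per_attains_sup by blast
  have "B v > 0"
  proof (rule ccontr)
    assume "\<not> ?thesis"
    then have ge: "1 \<le> equi_M K n h 1 u / \<kappa>" for u using v[of u] by (simp add: B_def)
    have "(LINT u:{0..2*pi}|lebesgue. 1) \<le> (LINT u:{0..2*pi}|lebesgue. equi_M K n h 1 u / \<kappa>)"
      by (rule set_integral_mono[OF L1_per_integrable[OF const_L1_per] set_integrable_divide[OF L1_per_integrable[OF C_per_L1_per[OF MC]]] ge])
    moreover have "(LINT u:{0..2*pi}|lebesgue. 1::real) = 2*pi" by (simp add: set_lebesgue_integral_def)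
    ultimately show False using equi_M_integral[OF K h(1) hpi, of n, folded \<kappa>_def] \<kappa> n by simp
  qed
  define lam where "lam = (1 + m' / \<bar>\<kappa>\<bar>) / B v"
  have lam: "lam > 0" using \<open>B v > 0\<close> \<open>m \<ge> 0\<close> m(2) \<kappa> by (simp add: lam_def add_pos_nonneg)
  have extreme: "1 - lam * B v = - m' / \<bar>\<kappa>\<bar>" using \<open>B v > 0\<close> by (simp add: lam_def)
  have ge: "1 - lam * B u \<ge> - m' / \<bar>\<kappa>\<bar>" for u
    using mult_left_mono[OF v[of u], of lam] lam extreme by linarith
  obtain u where u: "\<bar>equi_M K n h lam u\<bar> > m'" using large by blast
  note contra = no_uniformly_smaller_M_fun[OF CVD n h x lam, of c 0 m _ 0]
  show False
  proof (cases "\<kappa> > 0")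
    case True
    have "equi_M K n h lam v = - m'" using extreme True by (simp add: M)
    moreover have "equi_M K n h lam u \<ge> - m'"
      using mult_left_mono[OF ge[of u], of \<kappa>] True by (simp add: M)
    ultimately have "equi_M K n h lam u > m" "equi_M K n h lam v < - m" using u m(2) by linarith+
    then show False using contra[of u v] small by (simp add: mu)
  next
    case False
    then have neg: "\<kappa> < 0" using \<kappa> by simp
    have "equi_M K n h lam v = m'" using extreme neg by (simp add: M)
    moreover have "equi_M K n h lam u \<le> m'"
      using mult_left_mono_neg[OF ge[of u], of \<kappa>] neg by (simp add: M)
    ultimately have "equi_M K n h lam v > m" "equi_M K n h lam u < - m" using u m(2) by linarith+
    then show False using contra[of v u] small by (simp add: mu)
  qed
qed

theorem theorem1:
  fixes K :: "real \<Rightarrow> real" and n :: nat and h :: real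
  assumes "CVD_kernel K" and "n \<ge> 1" and "0 < h" and "h < pi / real n"
  shows "(mu K = 1 \<longrightarrow>
            optimal_error K n h = class_error K (equi_quad n h (2 * pi / real n)) \<and>
            class_error K (equi_quad n h (2 * pi / real n)) =
              (INF lam::real. Linf_norm (\<lambda>u. equi_M K n h (2 * pi / real n) u - lam))) \<and>
         (mu K = 0 \<longrightarrow>
            optimal_error K n h = (INF lam::real. class_error K (equi_quad n h lam)) \<and>
            (INF lam::real. class_error K (equi_quad n h lam)) =
              (INF lam::real. Linf_norm (equi_M K n h lam)))"
proof (intro conjI impI)
  have K: "K \<in> L1_per" using assms(1) by (simp add: CVD_kernel_def)
  have "pi / real n \<le> pi" using assms(2) by (simp add: divide_le_eq)
  then have hpi: "h < pi" using assms(4) by linarith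
  have Q: "equi_quad n h lam \<in> Q_set n h" for lam by (rule equi_quad_in_Q_set[OF assms(2-4)])
  {
    assume mu: "mu K = 1"
    let ?q = "equi_quad n h (2*pi / real n)" and ?M = "equi_M K n h (2*pi / real n)"
    show "optimal_error K n h = class_error K ?q"
      unfolding optimal_error_def
      by (intro antisym INF_lower INF_greatest Q equi_quad_optimal_mu_1[OF assms mu])
    have "?M \<in> C_per" by (rule M_fun_C_per[OF K assms(3) hpi])
    then have MC: "(\<lambda>u. ?M u - l) \<in> C_per" for l
      by (auto simp: C_per_def periodic_2pi_def intro: continuous_intros)
    have "(\<Sum>k=1..n. 2*pi / real n) = 2*pi" using assms(2) by simp
    then have iff: "class_error K ?q \<le> ereal m \<longleftrightarrow> (\<exists>l. Linf_norm (\<lambda>u. ?M u - l) \<le> ereal m)" for m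
      using class_error_le_iff_near_constant[OF K assms(3) hpi mu] Linf_norm_le_iff[OF MC] by simp
    show "class_error K ?q = (INF lam::real. Linf_norm (\<lambda>u. ?M u - lam))"
    proof (rule antisym)
      show "class_error K ?q \<le> (INF lam::real. Linf_norm (\<lambda>u. ?M u - lam))"
        by (rule INF_greatest, rule ereal_le_real) (use iff in blast)
      show "(INF lam::real. Linf_norm (\<lambda>u. ?M u - lam)) \<le> class_error K ?q"
      proof (rule ereal_le_real)
        fix m assume "class_error K ?q \<le> ereal m"
        then obtain l where "Linf_norm (\<lambda>u. ?M u - l) \<le> ereal m" using iff by blast
        then show "(INF lam::real. Linf_norm (\<lambda>u. ?M u - lam)) \<le> ereal m" by (rule INF_lower2[OF UNIV_I])
      qed
    qed
  }
  {
    assume mu: "mu K = 0"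
    show "optimal_error K n h = (INF lam::real. class_error K (equi_quad n h lam))"
      unfolding optimal_error_def
      by (intro antisym INF_greatest equi_quad_optimal_mu_0[OF assms mu]) (auto intro: INF_lower Q)
    show "(INF lam::real. class_error K (equi_quad n h lam)) = (INF lam::real. Linf_norm (equi_M K n h lam))"
      by (simp add: class_error_eq_Linf_norm[OF K assms(3) hpi mu])
  }
qed

end
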